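(* Let $Q$ be a finite quiver without loops or oriented 2-cycles, with vertex set $Q_0=\{1,\ldots,n\}$, let $\mathcal{A}_Q$ be the associated cluster algebra with initial cluster $(x_1,\ldots,x_n)$, and let $\sigma$ be a specialisation of some of the initial cluster variables to values in $\{1,-1\}$, with associated specialised cluster algebra $\mathcal{A}_Q|_\sigma$ and associated partial labelling of the vertices of $Q$. Then a vertex $j\in Q_0$ of the partially labelled quiver is polyamorous if and only if its neighbourhood is a polycule.
   Context: Cluster algebra. Let $Q$ be a finite quiver (multiple arrows allowed) without loops or oriented 2-cycles and with vertices $1,\ldots,n$. A seed is a quiver on the vertex set $\{1,\ldots,n\}$ together with a cluster, i.e. an $n$-tuple of elements of $\mathbb{Q}(x_1,\ldots,x_n)$; the initial seed is $Q$ with the initial cluster $(x_1,\ldots,x_n)$. The mutation $\mu_j$ of a seed changes the quiver as follows: all arrows incident to $j$ are reversed, every directed 2-path with central vertex $j$ is completed to an oriented triangle, and then oriented 2-cycles are removed (standard Fomin–Zelevinsky quiver mutation). It replaces the $j$-th cluster variable $x_j$ of the seed by $x_j'=\bigl(\prod_{i\to j}x_i+\prod_{j\to i}x_i\bigr)/x_j$, where the products run over the arrows into $j$ and out of $j$ in the quiver of the seed (with multiplicity), and leaves the other cluster variables unchanged. $\mathcal{A}_Q$ is the $\mathbb{Z}$-algebra generated by all cluster variables in all clusters obtained from the initial seed by finite sequences of mutations. By the Laurent phenomenon, $\mathcal{A}_Q\subset\mathbb{Z}[x_1^{\pm1},\ldots,x_n^{\pm1}]$. Specialisation. Specialisation relations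 $\sigma$ assign to each variable in some subset of the initial cluster variables a value in $\{1,-1\}$. The specialised cluster algebra $\mathcal{A}_Q|_\sigma$ is the image of $\mathcal{A}_Q$ under the ring homomorphism from $\mathbb{Z}[x_1^{\pm1},\ldots,x_n^{\pm1}]$ to the ring of Laurent polynomials over $\mathbb{Z}$ in the non-specialised initial cluster variables given by substituting the assigned values. The non-specialised initial cluster variables are called the variables of $\mathcal{A}_Q|_\sigma$. The associated partially labelled quiver is $Q$ with each vertex corresponding to a specialised variable labelled by the value assigned to it; the other vertices are unlabelled. Polyamorous. A variable $x_j$ of $\mathcal{A}_Q|_\sigma$ (and the corresponding, necessarily unlabelled, vertex $j$) is polyamorous if every element of $\mathcal{A}_Q|_\sigma$ is polynomial in $x_j$, i.e. contains no negative powers of $x_j$. Polycule. The neighbourhood of a vertex $v$ is the set consisting of $v$ and all vertices joined to $v$ by at least one arrow (in either direction). The neighbourhood of $v$ is a polycule if $v$ is not labelled, each neighbour of $v$ is labelled, and the number of arrows (counted with multiplicity) connecting $v$ with vertices labelled $-1$ is odd. *)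

theory Defs
  imports
    "HOL-Library.Poly_Mapping"
    "HOL-Computational_Algebra.Fraction_Field"
    Complex_Main
begin

section \<open>Quivers and their mutation\<close>

text \<open>
  A quiver on the vertex set \<open>{1..n}\<close> is given by its arrow multiplicities:
  \<open>Q i j\<close> is the number of arrows \<open>i \<rightarrow> j\<close>.
\<close>

type_synonym quiver = "nat \<Rightarrow> nat \<Rightarrow> nat"

definition is_quiver :: "nat \<Rightarrow> quiver \<Rightarrow> bool" where
  "is_quiver n Q \<longleftrightarrow>
     (\<forall>i j. Q i j \<noteq> 0 \<longrightarrow> i \<in> {1..n} \<and> j \<in> {1..n}) \<and>
     (\<forall>i. Q i i = 0) \<and>
     (\<forall>i j. Q i j = 0 \<or> Q j i = 0)"

text \<open>
  Every path \<open>a \<rightarrow> j \<rightarrow> b\<close> becomes \<open>b \<rightarrow> j \<rightarrow> a\<close> after the reversal of the arrows at \<open>j\<close>, so the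
  arrow that completes it to an oriented triangle is \<open>a \<rightarrow> b\<close>.
\<close>

definition reverse_and_complete :: "nat \<Rightarrow> quiver \<Rightarrow> quiver" where
  "reverse_and_complete j Q =
     (\<lambda>a b. if a = j \<or> b = j then Q b a else Q a b + Q a j * Q j b)"

text \<open>
  The subtraction is truncated: \<open>min (Q a b) (Q b a)\<close> pairs of opposite arrows are cancelled.
\<close>

definition remove_2_cycles :: "quiver \<Rightarrow> quiver" where
  "remove_2_cycles Q = (\<lambda>a b. Q a b - Q b a)"

definition mutate_quiver :: "nat \<Rightarrow> quiver \<Rightarrow> quiver" where
  "mutate_quiver j Q = remove_2_cycles (reverse_and_complete j Q)"


section \<open>Seeds and cluster algebras\<close>

text \<open>
  Rational functions over the rationals in the indeterminates \<open>X i\<close>, \<open>i :: nat\<close>. A quiver on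
  \<open>{1..n}\<close> only involves \<open>X 1, \<dots>, X n\<close>.
\<close>

type_synonym ratfun = "((nat \<Rightarrow>\<^sub>0 nat) \<Rightarrow>\<^sub>0 rat) fract"

definition X :: "nat \<Rightarrow> ratfun" where
  "X i = Fraction_Field.Fract (Poly_Mapping.single (Poly_Mapping.single i 1) 1) 1"

text \<open>
  The cluster of a seed is the family of the values at \<open>1, \<dots>, n\<close> of its second component; the
  values elsewhere are irrelevant.
\<close>

type_synonym seed = "quiver \<times> (nat \<Rightarrow> ratfun)"

definition initial_seed :: "quiver \<Rightarrow> seed" where
  "initial_seed Q = (Q, X)"

definition mutate_seed :: "nat \<Rightarrow> nat \<Rightarrow> seed \<Rightarrow> seed" where
  "mutate_seed n j = (\<lambda>(Q, x).
     (mutate_quiver j Q,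
      x(j := ((\<Prod>i\<in>{1..n}. x i ^ Q i j) + (\<Prod>i\<in>{1..n}. x i ^ Q j i)) / x j)))"

inductive_set seeds :: "nat \<Rightarrow> quiver \<Rightarrow> seed set" for n :: nat and Q :: quiver where
  initial: "initial_seed Q \<in> seeds n Q"
| mutate: "s \<in> seeds n Q \<Longrightarrow> j \<in> {1..n} \<Longrightarrow> mutate_seed n j s \<in> seeds n Q"

definition cluster_variables :: "nat \<Rightarrow> quiver \<Rightarrow> ratfun set" where
  "cluster_variables n Q = {snd s i | s i. s \<in> seeds n Q \<and> i \<in> {1..n}}"

inductive_set generated_subring :: "'a::ring_1 set \<Rightarrow> 'a set" for G :: "'a set" where
  generator: "g \<in> G \<Longrightarrow> g \<in> generated_subring G"
| one: "1 \<in> generated_subring G"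
| diff: "a \<in> generated_subring G \<Longrightarrow> b \<in> generated_subring G \<Longrightarrow> a - b \<in> generated_subring G"
| mult: "a \<in> generated_subring G \<Longrightarrow> b \<in> generated_subring G \<Longrightarrow> a * b \<in> generated_subring G"

definition cluster_algebra :: "nat \<Rightarrow> quiver \<Rightarrow> ratfun set" where
  "cluster_algebra n Q = generated_subring (cluster_variables n Q)"


section \<open>Laurent polynomials and specialisation\<close>

text \<open>
  Laurent polynomials over the integers: finitely supported families of integer coefficients
  indexed by exponent vectors in the integers, with the convolution product.
\<close>

type_synonym laurent = "(nat \<Rightarrow>\<^sub>0 int) \<Rightarrow>\<^sub>0 int"

definition ratfun_of_laurent :: "laurent \<Rightarrow> ratfun" where
  "ratfun_of_laurent p =
     (\<Sum>m\<in>Poly_Mapping.keys p. of_int (Poly_Mapping.lookup p m) *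
        (\<Prod>i\<in>Poly_Mapping.keys m. X i powi Poly_Mapping.lookup m i))"

text \<open>
  A partial map \<open>\<sigma>\<close> specialises the variables in its domain; it is at the same time the partial
  labelling of the vertices.
\<close>

definition is_specialisation :: "nat \<Rightarrow> (nat \<rightharpoonup> int) \<Rightarrow> bool" where
  "is_specialisation n \<sigma> \<longleftrightarrow> dom \<sigma> \<subseteq> {1..n} \<and> ran \<sigma> \<subseteq> {1, -1}"

text \<open>
  The image of the \<open>k\<close>-th power of the \<open>i\<close>-th variable. As \<open>a\<close> is \<open>1\<close> or \<open>-1\<close>, it is its own
  inverse, whence the absolute value in the exponent.
\<close>

definition specialise_power :: "(nat \<rightharpoonup> int) \<Rightarrow> nat \<Rightarrow> int \<Rightarrow> laurent" where
  "specialise_power \<sigma> i k =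
     (case \<sigma> i of
        None \<Rightarrow> Poly_Mapping.single (Poly_Mapping.single i k) 1
      | Some a \<Rightarrow> of_int (a ^ nat \<bar>k\<bar>))"

definition specialise :: "(nat \<rightharpoonup> int) \<Rightarrow> laurent \<Rightarrow> laurent" where
  "specialise \<sigma> p =
     (\<Sum>m\<in>Poly_Mapping.keys p. of_int (Poly_Mapping.lookup p m) *
        (\<Prod>i\<in>Poly_Mapping.keys m. specialise_power \<sigma> i (Poly_Mapping.lookup m i)))"

text \<open>
  By the Laurent phenomenon the cluster algebra lies in the image of the injective map
  \<^const>\<open>ratfun_of_laurent\<close>, so that its inverse is meaningful on the cluster algebra.
\<close>

definition specialised_cluster_algebra :: "nat \<Rightarrow> quiver \<Rightarrow> (nat \<rightharpoonup> int) \<Rightarrow> laurent set" where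
  "specialised_cluster_algebra n Q \<sigma> =
     (\<lambda>f. specialise \<sigma> (the_inv ratfun_of_laurent f)) ` cluster_algebra n Q"


section \<open>Polyamorous vertices and polycules\<close>

definition polynomial_in :: "nat \<Rightarrow> laurent \<Rightarrow> bool" where
  "polynomial_in j p \<longleftrightarrow> (\<forall>m\<in>Poly_Mapping.keys p. 0 \<le> Poly_Mapping.lookup m j)"

definition polyamorous :: "nat \<Rightarrow> quiver \<Rightarrow> (nat \<rightharpoonup> int) \<Rightarrow> nat \<Rightarrow> bool" where
  "polyamorous n Q \<sigma> j \<longleftrightarrow>
     \<sigma> j = None \<and> (\<forall>p\<in>specialised_cluster_algebra n Q \<sigma>. polynomial_in j p)"

definition neighbourhood :: "quiver \<Rightarrow> nat \<Rightarrow> nat set" where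
  "neighbourhood Q v = insert v {w. Q v w > 0 \<or> Q w v > 0}"

definition neighbourhood_is_polycule :: "quiver \<Rightarrow> (nat \<rightharpoonup> int) \<Rightarrow> nat \<Rightarrow> bool" where
  "neighbourhood_is_polycule Q \<sigma> v \<longleftrightarrow>
     \<sigma> v = None \<and>
     (\<forall>w\<in>neighbourhood Q v - {v}. \<sigma> w \<noteq> None) \<and>
     odd (\<Sum>w\<in>{w\<in>neighbourhood Q v. \<sigma> w = Some (-1)}. Q v w + Q w v)"

end

theory Submission
  imports Defs
begin

text \<open>
  Let \<open>P\<close> be the exchange polynomial of \<open>x_j\<close>, so that \<open>x_j' = P / x_j\<close>. By the Laurent phenomenon an
  element of the cluster algebra is a Laurent polynomial both in the initial cluster and in the
  one mutated at \<open>j\<close>; comparing the coefficients of the powers of \<open>x_j\<close> and \<open>x_j'\<close> shows that it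
  has the form \<open>P * g + u\<close> with \<open>u\<close> polynomial in \<open>x_j\<close>. As \<open>x_j'\<close> itself lies in the algebra, \<open>j\<close> is
  polyamorous if and only if \<open>P\<close> specialises to \<open>0\<close>. The two monomials of \<open>P\<close> have no variable in
  common, so they cancel exactly if all neighbours of \<open>j\<close> are labelled and the signs are opposite.

  The Laurent phenomenon is proved by induction on the length of the mutation sequence
  \<open>j, k, \<dots>\<close>, following Fomin and Zelevinsky: by induction the cluster variable is Laurent in the
  clusters after \<open>j\<close> and after \<open>j, k, j\<close>, so that only powers of \<open>P\<close>, respectively of the cluster
  variables \<open>Z\<close> and \<open>W\<close> of the latter cluster, can occur in the denominator. Coprimality is enforced
  by adjoining a frozen vertex \<open>y\<close> with an arrow to \<open>j\<close>: then \<open>P\<close> is linear in \<open>y\<close>, hence prime,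
  and it does not divide \<open>Z * W\<close>, as an evaluation at a zero of \<open>P\<close> shows. Setting \<open>y = 1\<close> removes
  the frozen vertex again.
\<close>

section \<open>Laurent polynomials, their substitutions and their embedding into rational
  functions\<close>

section \<open>Substitution in Laurent polynomials\<close>

text \<open>Reduces additive statements to single terms; applied to both factors in turn, it proves
  that the maps below are multiplicative.\<close>

lemma poly_mapping_single_induct [case_names zero single add]:
  fixes p :: "'k \<Rightarrow>\<^sub>0 'c::comm_monoid_add"
  assumes "P 0" "\<And>m c. P (Poly_Mapping.single m c)" "\<And>p q. P p \<Longrightarrow> P q \<Longrightarrow> P (p + q)"
  shows "P p"
proof (induction p rule: update_induct)
  case const
  then show ?case by (simp add: assms(1))
next
  case (update f a b)
  have "Poly_Mapping.update a b f = f + Poly_Mapping.single a b"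
    using update(1) by (intro poly_mapping_eqI)
      (auto simp: lookup_add lookup_update lookup_single in_keys_iff when_def)
  then show ?case using assms(2,3) update by simp
qed

text \<open>The value of a polynomial at the point with all coordinates 1, hence additive and
  multiplicative.\<close>

definition coeff_sum :: "('k \<Rightarrow>\<^sub>0 'c::comm_semiring_1) \<Rightarrow> 'c" where
  "coeff_sum p = (\<Sum>m\<in>Poly_Mapping.keys p. Poly_Mapping.lookup p m)"

lemma coeff_sum_0 [simp]: "coeff_sum 0 = 0"
  by (simp add: coeff_sum_def)

lemma coeff_sum_single [simp]: "coeff_sum (Poly_Mapping.single m c) = c"
  by (simp add: coeff_sum_def)

lemma coeff_sum_add: "coeff_sum (p + q) = coeff_sum p + coeff_sum q"
  unfolding coeff_sum_def by (rule setsum_keys_plus_distrib) auto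

lemma coeff_sum_mult:
  fixes p q :: "'k::comm_monoid_add \<Rightarrow>\<^sub>0 'c::comm_semiring_1"
  shows "coeff_sum (p * q) = coeff_sum p * coeff_sum q"
proof (induction p rule: poly_mapping_single_induct)
  case (single m c)
  show ?case
    by (induction q rule: poly_mapping_single_induct)
      (simp_all add: mult_single coeff_sum_add distrib_left)
qed (simp_all add: coeff_sum_add distrib_right)

text \<open>Prescribing the image of every power of a variable, not just of the variable, covers
  both evaluation in a field and specialisation to signs.\<close>

definition laurent_lift :: "(nat \<Rightarrow> int \<Rightarrow> 'a::comm_ring_1) \<Rightarrow> laurent \<Rightarrow> 'a" where
  "laurent_lift g p = (\<Sum>m\<in>Poly_Mapping.keys p. of_int (Poly_Mapping.lookup p m) *
     (\<Prod>i\<in>Poly_Mapping.keys m. g i (Poly_Mapping.lookup m i)))"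

lemma laurent_lift_0 [simp]: "laurent_lift g 0 = 0"
  by (simp add: laurent_lift_def)

lemma laurent_lift_add: "laurent_lift g (p + q) = laurent_lift g p + laurent_lift g q"
  unfolding laurent_lift_def by (rule setsum_keys_plus_distrib) (auto simp: distrib_right)

lemma laurent_lift_single:
  "laurent_lift g (Poly_Mapping.single m c) =
     of_int c * (\<Prod>i\<in>Poly_Mapping.keys m. g i (Poly_Mapping.lookup m i))"
  by (simp add: laurent_lift_def)

lemma laurent_lift_uminus: "laurent_lift g (- p) = - laurent_lift g p"
  using laurent_lift_add[of g p "- p"] by (simp add: eq_neg_iff_add_eq_0 add.commute)

lemma laurent_lift_diff: "laurent_lift g (p - q) = laurent_lift g p - laurent_lift g q"
  using laurent_lift_add[of g p "- q"] by (simp add: laurent_lift_uminus)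

locale laurent_substitution =
  fixes g :: "nat \<Rightarrow> int \<Rightarrow> 'a::comm_ring_1"
  assumes power_0: "g i 0 = 1" and power_plus: "g i (k + l) = g i k * g i l"
begin

lemma prod_superset:
  assumes "finite A" "Poly_Mapping.keys m \<subseteq> A"
  shows "(\<Prod>i\<in>Poly_Mapping.keys m. g i (Poly_Mapping.lookup m i)) =
    (\<Prod>i\<in>A. g i (Poly_Mapping.lookup m i))"
  using assms by (intro prod.mono_neutral_left) (auto simp: power_0 in_keys_iff)

lemma prod_add:
  "(\<Prod>i\<in>Poly_Mapping.keys (m + m'). g i (Poly_Mapping.lookup (m + m') i)) =
   (\<Prod>i\<in>Poly_Mapping.keys m. g i (Poly_Mapping.lookup m i)) *
   (\<Prod>i\<in>Poly_Mapping.keys m'. g i (Poly_Mapping.lookup m' i))"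
proof -
  let ?A = "Poly_Mapping.keys m \<union> Poly_Mapping.keys m'"
  have "Poly_Mapping.keys (m + m') \<subseteq> ?A" by (rule Poly_Mapping.keys_add)
  then show ?thesis
    using prod_superset[of ?A "m + m'"] prod_superset[of ?A m] prod_superset[of ?A m']
    by (simp add: lookup_add power_plus prod.distrib)
qed

lemma lift_1 [simp]: "laurent_lift g 1 = 1"
  using laurent_lift_single[of g 0 1] by simp

lemma lift_mult: "laurent_lift g (p * q) = laurent_lift g p * laurent_lift g q"
proof (induction p rule: poly_mapping_single_induct)
  case (single m c)
  show ?case
    by (induction q rule: poly_mapping_single_induct)
      (simp_all add: mult_single laurent_lift_add distrib_left laurent_lift_single prod_add)
qed (simp_all add: laurent_lift_add distrib_right)

lemma lift_power: "laurent_lift g (p ^ n) = laurent_lift g p ^ n"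
  by (induction n) (simp_all add: lift_mult)

lemma lift_sum: "laurent_lift g (sum p A) = (\<Sum>i\<in>A. laurent_lift g (p i))"
  by (induction A rule: infinite_finite_induct) (simp_all add: laurent_lift_add)

end

definition laurent_eval :: "(nat \<Rightarrow> 'a::field) \<Rightarrow> laurent \<Rightarrow> 'a" where
  "laurent_eval x = laurent_lift (\<lambda>i k. x i powi k)"

lemma ratfun_of_laurent_eq: "ratfun_of_laurent = laurent_eval X"
  by (simp add: fun_eq_iff ratfun_of_laurent_def laurent_eval_def laurent_lift_def)

lemma specialise_eq: "specialise \<sigma> = laurent_lift (specialise_power \<sigma>)"
  by (simp add: fun_eq_iff specialise_def laurent_lift_def)

lemma laurent_substitution_eval:
  fixes x :: "nat \<Rightarrow> 'a::field"
  assumes "\<And>i. x i \<noteq> 0"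
  shows "laurent_substitution (\<lambda>i k. x i powi k)"
  by standard (simp_all add: power_int_add assms)

lemma
  assumes "\<And>i. x i \<noteq> 0"
  shows laurent_eval_mult: "laurent_eval x (p * q) = laurent_eval x p * laurent_eval x q"
    and laurent_eval_power: "laurent_eval x (p ^ n) = laurent_eval x p ^ n"
    and laurent_eval_1: "laurent_eval x 1 = 1"
    and laurent_eval_sum: "laurent_eval x (sum f A) = (\<Sum>i\<in>A. laurent_eval x (f i))"
proof -
  interpret laurent_substitution "\<lambda>i k. x i powi k"
    by (rule laurent_substitution_eval) (rule assms)
  show "laurent_eval x (p * q) = laurent_eval x p * laurent_eval x q"
    "laurent_eval x (p ^ n) = laurent_eval x p ^ n" "laurent_eval x 1 = 1"
    "laurent_eval x (sum f A) = (\<Sum>i\<in>A. laurent_eval x (f i))"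
    by (simp_all add: laurent_eval_def lift_mult lift_power lift_sum)
qed

lemma laurent_eval_add: "laurent_eval x (p + q) = laurent_eval x p + laurent_eval x q"
  by (simp add: laurent_eval_def laurent_lift_add)

lemma laurent_eval_diff: "laurent_eval x (p - q) = laurent_eval x p - laurent_eval x q"
  by (simp add: laurent_eval_def laurent_lift_diff)

text \<open>A power of a sign depends only on the parity of the exponent, and absolute values
  preserve parity.\<close>

lemma specialise_power_sign:
  assumes "a = 1 \<or> a = (-1::int)"
  shows "a ^ nat \<bar>k + l\<bar> = a ^ nat \<bar>k\<bar> * a ^ nat \<bar>l\<bar>"
proof -
  have "even (nat \<bar>k + l\<bar>) \<longleftrightarrow> even (nat \<bar>k\<bar> + nat \<bar>l\<bar>)"
    by (simp add: even_nat_iff)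
  then show ?thesis
    using assms by (auto simp flip: power_add simp: minus_one_power_iff)
qed

lemma laurent_substitution_specialise:
  assumes "ran \<sigma> \<subseteq> {1, -1}"
  shows "laurent_substitution (specialise_power \<sigma>)"
proof
  fix i k l
  show "specialise_power \<sigma> i 0 = 1"
    by (cases "\<sigma> i") (simp_all add: specialise_power_def)
  show "specialise_power \<sigma> i (k + l) = specialise_power \<sigma> i k * specialise_power \<sigma> i l"
  proof (cases "\<sigma> i")
    case None
    then show ?thesis by (simp add: specialise_power_def mult_single single_add)
  next
    case (Some a)
    then have "a \<in> ran \<sigma>" by (auto simp: ran_def)
    with assms have "a = 1 \<or> a = -1" by auto
    with Some show ?thesis
      by (simp add: specialise_power_def specialise_power_sign del: of_int_power)
  qed
qed

lemma laurent_eval_specialise_one: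
  assumes "\<And>i. x i \<noteq> 0"
  shows "laurent_eval x (specialise [y \<mapsto> 1] p) = laurent_eval (x(y := 1)) p"
proof -
  have of_int_eval: "laurent_eval x (of_int c) = of_int c" for c
    using laurent_lift_single[of "\<lambda>i k. x i powi k" 0 c]
    by (simp add: laurent_eval_def flip: single_of_int)
  have prod_eval: "laurent_eval x (prod f A) = (\<Prod>i\<in>A. laurent_eval x (f i))" for f and A :: "nat set"
    by (induction A rule: infinite_finite_induct)
      (simp_all add: laurent_eval_1 laurent_eval_mult assms)
  have gen: "laurent_eval x (specialise_power [y \<mapsto> 1] i k) = (x(y := 1)) i powi k" for i k
    by (simp add: specialise_power_def laurent_eval_1 assms)
      (simp add: laurent_eval_def laurent_lift_single)
  show ?thesis
    unfolding specialise_def laurent_eval_sum[OF assms] laurent_eval_mult[OF assms]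
      prod_eval of_int_eval gen
    by (simp add: laurent_eval_def laurent_lift_def)
qed

section \<open>Monomials\<close>

abbreviation monomial :: "(nat \<Rightarrow>\<^sub>0 int) \<Rightarrow> laurent" where
  "monomial m \<equiv> Poly_Mapping.single m 1"

abbreviation unit_vec :: "nat \<Rightarrow> int \<Rightarrow> (nat \<Rightarrow>\<^sub>0 int)" where
  "unit_vec i k \<equiv> Poly_Mapping.single i k"

definition vec :: "nat set \<Rightarrow> (nat \<Rightarrow> int) \<Rightarrow> (nat \<Rightarrow>\<^sub>0 int)" where
  "vec V f = (\<Sum>i\<in>V. unit_vec i (f i))"

lemma lookup_vec: "finite V \<Longrightarrow> Poly_Mapping.lookup (vec V f) i = (if i \<in> V then f i else 0)"
  by (simp add: vec_def lookup_sum lookup_single when_def)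

lemma keys_vec: "finite V \<Longrightarrow> Poly_Mapping.keys (vec V f) \<subseteq> V"
  by (auto simp: in_keys_iff lookup_vec split: if_splits)

lemma monomial_mult: "monomial m * monomial m' = monomial (m + m')"
  by (simp add: mult_single)

lemma laurent_eval_monomial:
  assumes "\<And>i. x i \<noteq> 0" "finite V" "Poly_Mapping.keys m \<subseteq> V"
  shows "laurent_eval x (monomial m) = (\<Prod>i\<in>V. x i powi Poly_Mapping.lookup m i)"
proof -
  interpret laurent_substitution "\<lambda>i k. x i powi k"
    by (rule laurent_substitution_eval) (rule assms)
  show ?thesis
    using assms by (simp add: laurent_eval_def laurent_lift_single prod_superset[of V])
qed

lemma laurent_eval_monomial_nonzero:
  assumes "\<And>i. x i \<noteq> 0"
  shows "laurent_eval x (monomial m) \<noteq> 0"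
  by (simp add: laurent_eval_def laurent_lift_single assms)

lemma laurent_eval_unit_vec [simp]: "laurent_eval x (monomial (unit_vec i k)) = x i powi k"
  by (simp add: laurent_eval_def laurent_lift_single)

lemma laurent_eval_vec:
  assumes "\<And>i. x i \<noteq> 0" "finite V"
  shows "laurent_eval x (monomial (vec V f)) = (\<Prod>i\<in>V. x i powi f i)"
  by (subst laurent_eval_monomial[OF assms keys_vec[OF assms(2)]])
    (auto intro: prod.cong simp: lookup_vec assms)

section \<open>Positive rational functions\<close>

text \<open>A substitute for subtraction-free rational functions: fractions positive at the point
  with all coordinates 1. They are nonzero and closed under sums, products and quotients, so no
  mutation divides by zero.\<close>

definition pos_ratfuns :: "ratfun set" where
  "pos_ratfuns = {Fraction_Field.Fract a b | a b. coeff_sum a > 0 \<and> coeff_sum b > 0}"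

lemma pos_ratfunsE:
  assumes "f \<in> pos_ratfuns"
  obtains a b where "f = Fraction_Field.Fract a b" "coeff_sum a > 0" "coeff_sum b > 0" "a \<noteq> 0" "b \<noteq> 0"
  using assms by (fastforce simp: pos_ratfuns_def)

lemma pos_ratfuns_nonzero: "f \<in> pos_ratfuns \<Longrightarrow> f \<noteq> 0"
  by (erule pos_ratfunsE) (simp add: Zero_fract_def eq_fract)

lemma pos_ratfuns_add: "f \<in> pos_ratfuns \<Longrightarrow> g \<in> pos_ratfuns \<Longrightarrow> f + g \<in> pos_ratfuns"
proof (elim pos_ratfunsE)
  fix a b c d
  assume "f = Fraction_Field.Fract a b" "g = Fraction_Field.Fract c d" "b \<noteq> 0" "d \<noteq> 0"
    and pos: "coeff_sum a > 0" "coeff_sum b > 0" "coeff_sum c > 0" "coeff_sum d > 0"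
  moreover have "coeff_sum (a * d + c * b) > 0" "coeff_sum (b * d) > 0"
    using pos by (simp_all add: coeff_sum_add coeff_sum_mult add_pos_pos)
  ultimately show "f + g \<in> pos_ratfuns" unfolding pos_ratfuns_def by auto
qed

lemma pos_ratfuns_mult: "f \<in> pos_ratfuns \<Longrightarrow> g \<in> pos_ratfuns \<Longrightarrow> f * g \<in> pos_ratfuns"
proof (elim pos_ratfunsE)
  fix a b c d
  assume "f = Fraction_Field.Fract a b" "g = Fraction_Field.Fract c d"
    and pos: "coeff_sum a > 0" "coeff_sum b > 0" "coeff_sum c > 0" "coeff_sum d > 0"
  moreover have "coeff_sum (a * c) > 0" "coeff_sum (b * d) > 0"
    using pos by (simp_all add: coeff_sum_mult)
  ultimately show "f * g \<in> pos_ratfuns" unfolding pos_ratfuns_def by auto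
qed

lemma pos_ratfuns_inverse: "f \<in> pos_ratfuns \<Longrightarrow> inverse f \<in> pos_ratfuns"
  by (erule pos_ratfunsE) (auto simp: pos_ratfuns_def)

lemma pos_ratfuns_divide: "f \<in> pos_ratfuns \<Longrightarrow> g \<in> pos_ratfuns \<Longrightarrow> f / g \<in> pos_ratfuns"
  by (simp add: divide_inverse pos_ratfuns_mult pos_ratfuns_inverse)

lemma pos_ratfuns_1: "1 \<in> pos_ratfuns"
proof -
  have "coeff_sum (1 :: (nat \<Rightarrow>\<^sub>0 nat) \<Rightarrow>\<^sub>0 rat) = 1"
    using coeff_sum_single[of 0 "1::rat"] by simp
  then show ?thesis unfolding pos_ratfuns_def One_fract_def
    by (intro CollectI exI[of _ 1]) simp
qed

lemma pos_ratfuns_X: "X i \<in> pos_ratfuns"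
proof -
  have "coeff_sum (1 :: (nat \<Rightarrow>\<^sub>0 nat) \<Rightarrow>\<^sub>0 rat) = 1"
    using coeff_sum_single[of 0 "1::rat"] by simp
  then show ?thesis unfolding pos_ratfuns_def X_def
    by (intro CollectI exI[of _ "Poly_Mapping.single (Poly_Mapping.single i 1) 1"] exI[of _ 1]) simp
qed

lemma pos_ratfuns_power: "f \<in> pos_ratfuns \<Longrightarrow> f ^ k \<in> pos_ratfuns"
  by (induction k) (simp_all add: pos_ratfuns_1 pos_ratfuns_mult)

lemma pos_ratfuns_power_int: "f \<in> pos_ratfuns \<Longrightarrow> f powi k \<in> pos_ratfuns"
  by (simp add: power_int_def pos_ratfuns_power pos_ratfuns_inverse)

lemma pos_ratfuns_prod: "(\<And>i. i \<in> A \<Longrightarrow> f i \<in> pos_ratfuns) \<Longrightarrow> prod f A \<in> pos_ratfuns"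
  by (induction A rule: infinite_finite_induct) (simp_all add: pos_ratfuns_1 pos_ratfuns_mult)

section \<open>Laurent polynomials as rational functions\<close>

lemma X_nonzero: "X i \<noteq> 0"
  using pos_ratfuns_X pos_ratfuns_nonzero by blast

lemma X_power: "X i ^ k = Fraction_Field.Fract (Poly_Mapping.single (Poly_Mapping.single i k) 1) 1"
proof (induction k)
  case (Suc k)
  then show ?case
    by (simp add: X_def mult_single flip: single_add)
qed (simp add: One_fract_def)

lemma laurent_eval_X_nonneg_monomial:
  assumes "\<And>i. Poly_Mapping.lookup m i \<ge> 0"
  shows "laurent_eval X (monomial m) =
    Fraction_Field.Fract (Poly_Mapping.single (Poly_Mapping.map nat m) 1) 1"
proof -
  have *: "(\<Prod>i\<in>A. X i powi Poly_Mapping.lookup m i) =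
      Fraction_Field.Fract (Poly_Mapping.single (\<Sum>i\<in>A. Poly_Mapping.single i (nat (Poly_Mapping.lookup m i))) 1) 1"
    if "finite A" for A
    using that
  proof (induction A rule: finite_induct)
    case (insert a A)
    have "X a powi Poly_Mapping.lookup m a = X a ^ nat (Poly_Mapping.lookup m a)"
      using assms[of a] by (simp add: power_int_def)
    with insert show ?case by (simp add: X_power mult_single)
  qed (simp add: One_fract_def)
  have "(\<Sum>i\<in>Poly_Mapping.keys m. Poly_Mapping.single i (nat (Poly_Mapping.lookup m i))) = Poly_Mapping.map nat m"
    by (intro poly_mapping_eqI)
      (auto simp: lookup_sum lookup_single Poly_Mapping.map.rep_eq when_def in_keys_iff)
  with *[of "Poly_Mapping.keys m"] show ?thesis
    by (simp add: laurent_eval_def laurent_lift_single)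
qed

lemma add_fract_1: "Fraction_Field.Fract (a + b) 1 = Fraction_Field.Fract a 1 + Fraction_Field.Fract b 1"
  by simp

lemma Fract_sum_1: "Fraction_Field.Fract (sum f A) 1 = (\<Sum>i\<in>A. Fraction_Field.Fract (f i) 1)"
  by (induction A rule: infinite_finite_induct) (simp_all add: Zero_fract_def add_fract_1)

lemma Fract_of_int_1: "Fraction_Field.Fract (of_int c) 1 = of_int c"
  by (cases c) (simp_all add: of_nat_fract One_fract_def)

text \<open>With nonnegative exponents the value is an ordinary polynomial over 1, in which distinct
  exponent vectors stay distinct, so no coefficient is lost.\<close>

lemma laurent_eval_X_nonneg:
  assumes nonneg: "\<And>m i. m \<in> Poly_Mapping.keys p \<Longrightarrow> Poly_Mapping.lookup m i \<ge> 0"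
    and "laurent_eval X p = 0"
  shows "p = 0"
proof (rule ccontr)
  assume "p \<noteq> 0"
  then obtain m where m: "m \<in> Poly_Mapping.keys p"
    using keys_eq_empty by blast
  \<comment> \<open>\<open>p\<close> with its exponents read as naturals and its coefficients as
    rationals.\<close>
  define q :: "(nat \<Rightarrow>\<^sub>0 nat) \<Rightarrow>\<^sub>0 rat" where
    "q = (\<Sum>m\<in>Poly_Mapping.keys p. Poly_Mapping.single (Poly_Mapping.map nat m) (of_int (Poly_Mapping.lookup p m)))"
  have inj: "inj_on (Poly_Mapping.map nat) (Poly_Mapping.keys p)"
  proof (rule inj_onI)
    fix a b assume ab: "a \<in> Poly_Mapping.keys p" "b \<in> Poly_Mapping.keys p"
      "Poly_Mapping.map nat a = Poly_Mapping.map nat b"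
    show "a = b"
    proof (rule poly_mapping_eqI)
      fix i
      have "nat (Poly_Mapping.lookup a i) = nat (Poly_Mapping.lookup b i)"
        using arg_cong[OF ab(3), of "\<lambda>f. Poly_Mapping.lookup f i"]
        by (simp add: Poly_Mapping.map.rep_eq when_def split: if_splits)
      then show "Poly_Mapping.lookup a i = Poly_Mapping.lookup b i"
        using nonneg ab by (simp add: eq_nat_nat_iff)
    qed
  qed
  have "laurent_eval X p =
      (\<Sum>m\<in>Poly_Mapping.keys p. of_int (Poly_Mapping.lookup p m) * laurent_eval X (monomial m))"
    by (simp add: laurent_eval_def laurent_lift_def)
  also have "\<dots> = (\<Sum>m\<in>Poly_Mapping.keys p. Fraction_Field.Fract (Poly_Mapping.single (Poly_Mapping.map nat m) (of_int (Poly_Mapping.lookup p m))) 1)"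
  proof (intro sum.cong refl)
    fix m assume "m \<in> Poly_Mapping.keys p"
    then have "laurent_eval X (monomial m) = Fraction_Field.Fract (Poly_Mapping.single (Poly_Mapping.map nat m) 1) 1"
      using nonneg laurent_eval_X_nonneg_monomial by blast
    then have "of_int (Poly_Mapping.lookup p m) * laurent_eval X (monomial m)
       = Fraction_Field.Fract (of_int (Poly_Mapping.lookup p m)) 1 * Fraction_Field.Fract (Poly_Mapping.single (Poly_Mapping.map nat m) 1) 1"
      by (simp only: Fract_of_int_1)
    also have "\<dots> = Fraction_Field.Fract (Poly_Mapping.single (Poly_Mapping.map nat m) (of_int (Poly_Mapping.lookup p m))) 1"
      by (simp add: mult_single flip: single_of_int)
    finally show "of_int (Poly_Mapping.lookup p m) * laurent_eval X (monomial m) = \<dots>" .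
  qed
  also have "\<dots> = Fraction_Field.Fract q 1"
    by (simp add: q_def Fract_sum_1)
  finally have "q = 0"
    using assms(2) by (simp add: Zero_fract_def eq_fract)
  have "Poly_Mapping.lookup q (Poly_Mapping.map nat m) =
      (\<Sum>m'\<in>Poly_Mapping.keys p. if m' = m then of_int (Poly_Mapping.lookup p m) else 0)"
    unfolding q_def lookup_sum
    by (intro sum.cong refl) (use inj m in \<open>auto simp: lookup_single when_def inj_on_def\<close>)
  also have "\<dots> \<noteq> 0" using m by (simp add: in_keys_iff)
  finally show False using \<open>q = 0\<close> by simp
qed

text \<open>A monomial factor clears the negative exponents; for each variable the sum of the
  absolute values of its exponents is large enough.\<close>

lemma laurent_eval_X_eq_0:
  assumes "laurent_eval X p = 0"
  shows "p = 0"
proof -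
  define A where "A = (\<Union>m\<in>Poly_Mapping.keys p. Poly_Mapping.keys m)"
  define d where "d = vec A (\<lambda>i. \<Sum>m\<in>Poly_Mapping.keys p. \<bar>Poly_Mapping.lookup m i\<bar>)"
  have fin: "finite A" by (simp add: A_def)
  have "monomial d * p = 0"
  proof (rule laurent_eval_X_nonneg)
    fix m i assume "m \<in> Poly_Mapping.keys (monomial d * p)"
    then obtain m' where m': "m = d + m'" "m' \<in> Poly_Mapping.keys p"
      using Poly_Mapping.keys_mult[of "monomial d" p] by auto
    show "0 \<le> Poly_Mapping.lookup m i"
    proof (cases "i \<in> A")
      case True
      have "\<bar>Poly_Mapping.lookup m' i\<bar> \<le> (\<Sum>m\<in>Poly_Mapping.keys p. \<bar>Poly_Mapping.lookup m i\<bar>)"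
        using m'(2) by (intro member_le_sum) auto
      then show ?thesis
        using True fin by (simp add: m'(1) d_def lookup_add lookup_vec)
    next
      case False
      then have "Poly_Mapping.lookup m' i = 0"
        using m'(2) by (auto simp: A_def in_keys_iff)
      then show ?thesis using False fin by (simp add: m'(1) d_def lookup_add lookup_vec)
    qed
  qed (simp add: laurent_eval_mult X_nonzero assms)
  then show "p = 0" by (auto dest: arg_cong[of _ _ Poly_Mapping.keys])
qed

lemma laurent_eval_X_inj: "inj (laurent_eval X)"
proof (rule injI)
  fix p q assume "laurent_eval X p = laurent_eval X q"
  then have "laurent_eval X (p - q) = 0" by (simp add: laurent_eval_diff)
  then show "p = q" using laurent_eval_X_eq_0 by fastforce
qed

section \<open>Degrees in one variable and prime binomials\<close>

section \<open>Exponents of one variable\<close>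

text \<open>\<open>A\<close> is \<open>{0}\<close> for Laurent polynomials free of the variable and
  \<open>{0..}\<close> for those polynomial in it.\<close>

definition exponents_in :: "nat \<Rightarrow> int set \<Rightarrow> laurent \<Rightarrow> bool" where
  "exponents_in j A p \<longleftrightarrow> (\<forall>m\<in>Poly_Mapping.keys p. Poly_Mapping.lookup m j \<in> A)"

lemma exponents_in_0: "exponents_in j A 0"
  by (simp add: exponents_in_def)

lemma exponents_in_single: "Poly_Mapping.lookup m j \<in> A \<Longrightarrow> exponents_in j A (Poly_Mapping.single m c)"
  by (simp add: exponents_in_def)

lemma exponents_in_add: "exponents_in j A p \<Longrightarrow> exponents_in j A q \<Longrightarrow> exponents_in j A (p + q)"
  using Poly_Mapping.keys_add[of p q] by (auto simp: exponents_in_def)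

lemma exponents_in_uminus: "exponents_in j A p \<Longrightarrow> exponents_in j A (- p)"
  by (simp add: exponents_in_def)

lemma exponents_in_diff: "exponents_in j A p \<Longrightarrow> exponents_in j A q \<Longrightarrow> exponents_in j A (p - q)"
  using exponents_in_add[of j A p "- q"] by (simp add: exponents_in_uminus)

lemma exponents_in_mult:
  assumes "exponents_in j A p" "exponents_in j B q" "\<And>a b. a \<in> A \<Longrightarrow> b \<in> B \<Longrightarrow> a + b \<in> C"
  shows "exponents_in j C (p * q)"
  unfolding exponents_in_def
proof
  fix m assume "m \<in> Poly_Mapping.keys (p * q)"
  then obtain a b where "m = a + b" "a \<in> Poly_Mapping.keys p" "b \<in> Poly_Mapping.keys q"
    using Poly_Mapping.keys_mult[of p q] by auto
  then show "Poly_Mapping.lookup m j \<in> C"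
    using assms by (auto simp: exponents_in_def lookup_add)
qed

lemma exponents_in_power:
  assumes "exponents_in j A p" "\<And>a b. a \<in> A \<Longrightarrow> b \<in> A \<Longrightarrow> a + b \<in> A" "0 \<in> A"
  shows "exponents_in j A (p ^ n)"
proof (induction n)
  case 0
  show ?case using assms(3) by (simp add: exponents_in_def)
next
  case (Suc n)
  then show ?case using exponents_in_mult[OF assms(1) Suc] assms(2) by simp
qed

lemma laurent_eval_cong:
  assumes "\<And>m i. m \<in> Poly_Mapping.keys p \<Longrightarrow> i \<in> Poly_Mapping.keys m \<Longrightarrow> x i = x' i"
  shows "laurent_eval x p = laurent_eval x' p"
  unfolding laurent_eval_def laurent_lift_def
  by (intro sum.cong prod.cong refl arg_cong2[where f = "(*)"]) (simp add: assms)

lemma laurent_eval_fun_upd: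
  assumes "exponents_in j {0} p"
  shows "laurent_eval (x(j := v)) p = laurent_eval x p"
  by (rule laurent_eval_cong) (use assms in \<open>auto simp: exponents_in_def in_keys_iff\<close>)

text \<open>
  As \<open>q\<close> is free of the \<open>j\<close>-th variable, it multiplies the part of \<open>p\<close> with negative exponents
  to the part of \<open>q * p\<close> with negative exponents, which is zero.
\<close>

lemma exponents_in_cancel:
  assumes "exponents_in j {0} q" "q \<noteq> 0" "exponents_in j {0..} (q * p)"
  shows "exponents_in j {0..} p"
proof -
  define neg where "neg = (\<Sum>m\<in>{m\<in>Poly_Mapping.keys p. Poly_Mapping.lookup m j < 0}.
    Poly_Mapping.single m (Poly_Mapping.lookup p m))"
  have lookup_neg: "Poly_Mapping.lookup neg m = (if Poly_Mapping.lookup m j < 0 then Poly_Mapping.lookup p m else 0)" for m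
    by (simp add: neg_def lookup_sum lookup_single when_def in_keys_iff)
  have neg: "exponents_in j {..<0} neg" and pos: "exponents_in j {0..} (p - neg)"
    by (auto simp: exponents_in_def in_keys_iff lookup_neg lookup_minus split: if_splits)
  have "exponents_in j {0..} (q * p - q * (p - neg))"
    by (intro exponents_in_diff assms(3) exponents_in_mult[OF assms(1) pos]) auto
  moreover have "q * p - q * (p - neg) = q * neg" by (simp add: algebra_simps)
  moreover have "exponents_in j {..<0} (q * neg)"
    by (rule exponents_in_mult[OF assms(1) neg]) auto
  ultimately have "q * neg = 0"
    by (force simp: exponents_in_def simp flip: keys_eq_empty)
  then have "neg = 0" using assms(2) by simp
  then show ?thesis using pos by simp
qed

text \<open>\<open>frag_cmul\<close> is the integer multiple of an exponent vector.\<close>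

lemma monomial_power: "monomial v ^ n = monomial (frag_cmul (int n) v)"
proof (induction n)
  case (Suc n)
  have "v + frag_cmul (int n) v = frag_cmul (int (Suc n)) v"
    by (intro poly_mapping_eqI) (simp add: lookup_add algebra_simps)
  with Suc show ?case by (simp add: mult_single)
qed simp

section \<open>Binomials linear in a variable are prime\<close>

text \<open>Monomials are units, so modulo \<open>P\<close> both \<open>y\<close> and its inverse
  are congruent to negated monomials free of \<open>y\<close>. Hence every power of \<open>y\<close>
  can be replaced.\<close>

lemma reduce_mod_linear:
  fixes m m' :: "nat \<Rightarrow>\<^sub>0 int"
  assumes P: "P = monomial (unit_vec y 1 + m) + monomial m'"
    and "Poly_Mapping.lookup m y = 0" "Poly_Mapping.lookup m' y = 0"
  shows "\<exists>q r. f = P * q + r \<and> exponents_in y {0} r"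
proof (induction f rule: poly_mapping_single_induct)
  case zero
  show ?case by (intro exI[of _ 0]) (simp add: exponents_in_0)
next
  case (add f g)
  then obtain q r q' r' where "f = P * q + r" "exponents_in y {0} r"
    "g = P * q' + r'" "exponents_in y {0} r'" by blast
  then show ?case
    by (intro exI[of _ "q + q'"] exI[of _ "r + r'"])
      (simp add: distrib_left exponents_in_add)
next
  case (single a c)
  define k where "k = Poly_Mapping.lookup a y"
  define a0 where "a0 = a - unit_vec y k"
  \<comment> \<open>\<open>U\<close> is the residue of \<open>y\<close>, and \<open>U'\<close> that
    of its inverse.\<close>
  define U where "U = - monomial (m' - m)"
  define U' where "U' = - monomial (m - m')"
  have a0: "Poly_Mapping.lookup a0 y = 0" by (simp add: a0_def k_def lookup_minus)
  have YU: "monomial (unit_vec y 1) - U = P * monomial (- m)"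
    by (simp add: P U_def distrib_right mult_single)
  have "monomial (unit_vec y (-1)) - U' = P * (monomial (- m) * monomial (unit_vec y (-1)) * (- U'))"
    by (simp add: P U'_def mult_single algebra_simps flip: single_add)
  then have YU': "P dvd monomial (unit_vec y (-1)) - U'" by simp
  have pow: "P dvd A ^ n - B ^ n" if "P dvd A - B" for A B and n :: nat
    using that by (metis dvd_mult2 power_diff_sumr2)
  have free_U: "exponents_in y {0} U" "exponents_in y {0} U'"
    by (auto simp: U_def U'_def assms lookup_minus intro!: exponents_in_uminus exponents_in_single)
  obtain r where r: "P dvd monomial (unit_vec y k) - r" "exponents_in y {0} r"
  proof (cases "k \<ge> 0")
    case True
    have "monomial (unit_vec y k) = monomial (unit_vec y 1) ^ nat k"
      unfolding monomial_power using True by (intro arg_cong[of _ _ monomial] poly_mapping_eqI) (simp add: lookup_single)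
    moreover have "P dvd monomial (unit_vec y 1) ^ nat k - U ^ nat k"
      by (rule pow) (simp add: YU)
    ultimately show thesis using free_U by (intro that[of "U ^ nat k"]) (auto intro: exponents_in_power)
  next
    case False
    have "monomial (unit_vec y k) = monomial (unit_vec y (-1)) ^ nat (- k)"
      unfolding monomial_power using False by (intro arg_cong[of _ _ monomial] poly_mapping_eqI) (simp add: lookup_single when_def)
    moreover have "P dvd monomial (unit_vec y (-1)) ^ nat (- k) - U' ^ nat (- k)"
      by (rule pow) (rule YU')
    ultimately show thesis using free_U by (intro that[of "U' ^ nat (- k)"]) (auto intro: exponents_in_power)
  qed
  from r(1) obtain q where q: "monomial (unit_vec y k) - r = P * q" by (auto elim: dvdE)
  have "Poly_Mapping.single a c = Poly_Mapping.single a0 c * monomial (unit_vec y k)"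
    by (simp add: mult_single a0_def)
  also have "\<dots> = Poly_Mapping.single a0 c * (P * q + r)"
    using q by (simp add: algebra_simps)
  also have "\<dots> = P * (Poly_Mapping.single a0 c * q) + Poly_Mapping.single a0 c * r"
    by (simp add: algebra_simps)
  finally have "Poly_Mapping.single a c = P * (Poly_Mapping.single a0 c * q) + Poly_Mapping.single a0 c * r" .
  moreover have "exponents_in y {0} (Poly_Mapping.single a0 c * r)"
    by (rule exponents_in_mult[OF exponents_in_single r(2)]) (auto simp: a0)
  ultimately show ?case by blast
qed

text \<open>\<open>P\<close> divides exactly the Laurent polynomials that vanish at its root
  \<open>y = u\<close>, and the values lie in a field.\<close>

lemma linear_binomial_prime:
  fixes m m' :: "nat \<Rightarrow>\<^sub>0 int"
  assumes P: "P = monomial (unit_vec y 1 + m) + monomial m'"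
    and y: "Poly_Mapping.lookup m y = 0" "Poly_Mapping.lookup m' y = 0"
    and "P dvd f * g"
  shows "P dvd f \<or> P dvd g"
proof -
  \<comment> \<open>The root of \<open>P\<close> as a linear polynomial in \<open>y\<close> over the
    rational functions; it is nonzero, so negative powers can be evaluated.\<close>
  define u where "u = - laurent_eval X (monomial (m' - m))"
  define \<xi> where "\<xi> = X(y := u)"
  have \<xi>: "\<xi> i \<noteq> 0" for i
    by (simp add: \<xi>_def u_def X_nonzero laurent_eval_monomial_nonzero)
  have free: "laurent_eval \<xi> r = laurent_eval X r" if "exponents_in y {0} r" for r
    using that by (simp add: \<xi>_def laurent_eval_fun_upd)
  have "laurent_eval \<xi> (monomial (unit_vec y 1 + m)) = u * laurent_eval X (monomial m)"
    by (subst monomial_mult[symmetric], subst laurent_eval_mult[OF \<xi>])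
      (simp add: free exponents_in_single y, simp add: \<xi>_def)
  also have "\<dots> = - laurent_eval X (monomial m')"
    by (simp add: u_def X_nonzero mult_single flip: laurent_eval_mult)
  finally have "laurent_eval \<xi> P = 0"
    by (simp add: P laurent_eval_add free exponents_in_single y)
  \<comment> \<open>The remainder modulo \<open>P\<close> is free of \<open>y\<close>, so its value
    at the root is its value at \<open>X\<close>, which vanishes only for the zero
    polynomial.\<close>
  have root: "P dvd h" if "laurent_eval \<xi> h = 0" for h
  proof -
    obtain q r where qr: "h = P * q + r" "exponents_in y {0} r"
      using reduce_mod_linear[OF P y] by blast
    then have "laurent_eval X r = 0"
      using that \<open>laurent_eval \<xi> P = 0\<close> by (simp add: laurent_eval_add laurent_eval_mult \<xi> free)
    then have "r = 0" by (rule laurent_eval_X_eq_0)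
    then show ?thesis using qr by simp
  qed
  from assms(4) obtain q where "f * g = P * q" by (auto elim: dvdE)
  then have "laurent_eval \<xi> f * laurent_eval \<xi> g = 0"
    using \<open>laurent_eval \<xi> P = 0\<close> by (metis \<xi> laurent_eval_mult mult_zero_left)
  then show ?thesis using root by auto
qed

lemma prime_power_dvd_cancel:
  fixes P :: "'a::idom"
  assumes prime: "\<And>f g. P dvd f * g \<Longrightarrow> P dvd f \<or> P dvd g"
    and "P \<noteq> 0" "\<not> P dvd E" "P ^ n dvd A * E"
  shows "P ^ n dvd A"
  using assms(4)
proof (induction n arbitrary: A)
  case (Suc n)
  then have "P dvd A * E" by (metis dvd_mult_left power_Suc)
  then have "P dvd A" using prime[of A E] assms(3) by blast
  then obtain A' where A': "A = P * A'" by (auto elim: dvdE)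
  then have "P ^ n dvd A' * E" using Suc.prems assms(2) by (simp add: A' mult.assoc)
  then have "P ^ n dvd A'" by (rule Suc.IH)
  then show ?case unfolding A' power_Suc by (rule mult_dvd_mono[OF dvd_refl])
qed simp

section \<open>Seeds with skew-symmetric matrices\<close>

section \<open>Mutation of skew-symmetric matrices\<close>

text \<open>Here \<open>b a c\<close> is a signed count: arrows from \<open>a\<close> to
  \<open>c\<close> minus arrows from \<open>c\<close> to \<open>a\<close>. The two products count
  the paths \<open>a -> j -> c\<close> and \<open>c -> j -> a\<close>.\<close>

definition mutate_matrix :: "nat \<Rightarrow> (nat \<Rightarrow> nat \<Rightarrow> int) \<Rightarrow> nat \<Rightarrow> nat \<Rightarrow> int" where
  "mutate_matrix j b = (\<lambda>a c. if a = j \<or> c = j then - b a c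
     else b a c + max 0 (b a j) * max 0 (b j c) - max 0 (- b a j) * max 0 (- b j c))"

definition skew_on :: "nat set \<Rightarrow> (nat \<Rightarrow> nat \<Rightarrow> int) \<Rightarrow> bool" where
  "skew_on V b \<longleftrightarrow> (\<forall>i k. b k i = - b i k) \<and> (\<forall>i k. b i k \<noteq> 0 \<longrightarrow> i \<in> V \<and> k \<in> V)"

text \<open>The numerator of the exchange relation, incoming arrows first. It is kept formal, to be
  evaluated at any cluster and tested for divisibility.\<close>

definition exchange_poly :: "nat set \<Rightarrow> (nat \<Rightarrow> nat \<Rightarrow> int) \<Rightarrow> nat \<Rightarrow> laurent" where
  "exchange_poly V b j =
     monomial (vec V (\<lambda>i. max 0 (b i j))) + monomial (vec V (\<lambda>i. max 0 (- b i j)))"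

lemma skew_on_sym: "skew_on V b \<Longrightarrow> b k i = - b i k"
  unfolding skew_on_def by blast

lemma skew_on_diag: "skew_on V b \<Longrightarrow> b i i = 0"
  using skew_on_sym[of V b i i] by linarith

lemma skew_on_outside: "skew_on V b \<Longrightarrow> i \<notin> V \<or> k \<notin> V \<Longrightarrow> b i k = 0"
  unfolding skew_on_def by blast

lemma skew_on_mutate:
  assumes "skew_on V b"
  shows "skew_on V (mutate_matrix j b)"
proof -
  have "mutate_matrix j b k i = - mutate_matrix j b i k" for i k
    unfolding mutate_matrix_def
      skew_on_sym[OF assms, of k i] skew_on_sym[OF assms, of k j] skew_on_sym[OF assms, of j i]
    by simp
  moreover have "mutate_matrix j b i k = 0" if "i \<notin> V \<or> k \<notin> V" for i k
    using that skew_on_outside[OF assms] by (auto simp: mutate_matrix_def)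
  ultimately show ?thesis unfolding skew_on_def by blast
qed

lemma mutate_matrix_involution: "mutate_matrix j (mutate_matrix j b) = b"
  by (simp add: mutate_matrix_def fun_eq_iff)

lemma mutate_matrix_uminus:
  "mutate_matrix j (\<lambda>i k. - b i k) = (\<lambda>i k. - mutate_matrix j b i k)"
  by (simp add: mutate_matrix_def fun_eq_iff)

lemma exchange_poly_uminus: "exchange_poly V (\<lambda>i k. - b i k) j = exchange_poly V b j"
  by (simp add: exchange_poly_def add.commute)

lemma exchange_poly_mutate: "exchange_poly V (mutate_matrix j b) j = exchange_poly V b j"
  by (simp add: exchange_poly_def mutate_matrix_def add.commute)

lemma exponents_in_exchange_poly:
  assumes "finite V" "skew_on V b"
  shows "exponents_in j {0} (exchange_poly V b j)"
  unfolding exchange_poly_def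
  by (intro exponents_in_add exponents_in_single)
    (simp_all add: lookup_vec skew_on_diag[OF assms(2)] assms(1))

lemma laurent_eval_exchange_poly:
  assumes "finite V" "\<And>i. x i \<noteq> 0"
  shows "laurent_eval x (exchange_poly V b j) =
    (\<Prod>i\<in>V. x i powi max 0 (b i j)) + (\<Prod>i\<in>V. x i powi max 0 (- b i j))"
  using assms by (simp add: exchange_poly_def laurent_eval_add laurent_eval_vec)

lemma pos_ratfuns_exchange_poly:
  assumes "finite V" "\<And>i. x i \<in> pos_ratfuns"
  shows "laurent_eval x (exchange_poly V b j) \<in> pos_ratfuns"
  using assms by (subst laurent_eval_exchange_poly)
    (auto intro!: pos_ratfuns_add pos_ratfuns_prod pos_ratfuns_power_int simp: pos_ratfuns_nonzero)

type_synonym matrix_seed = "(nat \<Rightarrow> nat \<Rightarrow> int) \<times> (nat \<Rightarrow> ratfun)"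

text \<open>The cluster is arbitrary, because later clusters serve as new initial clusters.\<close>

definition mutate :: "nat set \<Rightarrow> nat \<Rightarrow> matrix_seed \<Rightarrow> matrix_seed" where
  "mutate V j = (\<lambda>(b, x). (mutate_matrix j b, x(j := laurent_eval x (exchange_poly V b j) / x j)))"

abbreviation mutate_along :: "nat set \<Rightarrow> nat list \<Rightarrow> matrix_seed \<Rightarrow> matrix_seed" where
  "mutate_along V \<equiv> fold (mutate V)"

lemma mutate_pos:
  assumes "finite V" "\<And>i. x i \<in> pos_ratfuns"
  shows "snd (mutate V j (b, x)) i \<in> pos_ratfuns"
  using assms by (simp add: mutate_def pos_ratfuns_divide pos_ratfuns_exchange_poly)

text \<open>Both mutations use the same exchange polynomial, with the same value since it is free of
  \<open>x_j\<close>. Positivity makes that value nonzero, so dividing it by the new variable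
  returns \<open>x_j\<close>.\<close>

lemma mutate_involution:
  assumes "finite V" "skew_on V b" "\<And>i. x i \<in> pos_ratfuns"
  shows "mutate V j (mutate V j (b, x)) = (b, x)"
proof -
  have "laurent_eval x (exchange_poly V b j) \<noteq> 0"
    using assms by (intro pos_ratfuns_nonzero pos_ratfuns_exchange_poly)
  then show ?thesis
    using assms exponents_in_exchange_poly[of V b j]
    by (auto simp: mutate_def mutate_matrix_involution exchange_poly_mutate laurent_eval_fun_upd fun_eq_iff)
qed

lemma mutate_uminus:
  "mutate V j (\<lambda>i k. - b i k, x) = (\<lambda>i k. - fst (mutate V j (b, x)) i k, snd (mutate V j (b, x)))"
  by (simp add: mutate_def mutate_matrix_uminus exchange_poly_uminus)

text \<open>Reversing all arrows leaves the clusters unchanged; this allows the assumption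
  \<open>b j k \<ge> 0\<close> later.\<close>

lemma mutate_along_uminus:
  "mutate_along V p (\<lambda>i k. - b i k, x) =
    (\<lambda>i k. - fst (mutate_along V p (b, x)) i k, snd (mutate_along V p (b, x)))"
proof (induction p arbitrary: b x)
  case (Cons j p)
  show ?case
    using Cons.IH[of "fst (mutate V j (b, x))" "snd (mutate V j (b, x))"] by (simp add: mutate_uminus)
qed simp

section \<open>Proof of the Laurent phenomenon\<close>

section \<open>Localised Laurent polynomials\<close>

text \<open>Membership in the Laurent polynomials with \<open>D\<close> inverted, for a function of
  the cluster; \<open>N\<close> and \<open>A\<close> are the same for all clusters.\<close>

definition localised :: "laurent \<Rightarrow> ((nat \<Rightarrow> ratfun) \<Rightarrow> ratfun) \<Rightarrow> bool" where
  "localised D F \<longleftrightarrow> (\<exists>N A. \<forall>x. (\<forall>i. x i \<in> pos_ratfuns) \<longrightarrow>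
     F x * laurent_eval x D ^ N = laurent_eval x A)"

lemma localisedI:
  "(\<And>x. (\<And>i. x i \<in> pos_ratfuns) \<Longrightarrow> F x * laurent_eval x D ^ N = laurent_eval x A) \<Longrightarrow> localised D F"
  unfolding localised_def by blast

lemma localised_laurent_eval: "localised D (\<lambda>x. laurent_eval x p)"
  by (rule localisedI[of _ _ 0 p]) simp

lemma localised_const: "localised D (\<lambda>x. of_int c)"
  using localised_laurent_eval[of D "Poly_Mapping.single 0 c"]
  by (simp add: laurent_eval_def laurent_lift_single)

lemma localised_cong:
  assumes "localised D F" "\<And>x. (\<And>i. x i \<in> pos_ratfuns) \<Longrightarrow> F x = G x"
  shows "localised D G"
  using assms unfolding localised_def by metis

lemma localised_add:
  assumes "localised D F" "localised D G"
  shows "localised D (\<lambda>x. F x + G x)"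
proof -
  obtain N A where A: "\<And>x. (\<And>i. x i \<in> pos_ratfuns) \<Longrightarrow> F x * laurent_eval x D ^ N = laurent_eval x A"
    using assms(1) unfolding localised_def by blast
  obtain M B where B: "\<And>x. (\<And>i. x i \<in> pos_ratfuns) \<Longrightarrow> G x * laurent_eval x D ^ M = laurent_eval x B"
    using assms(2) unfolding localised_def by blast
  show ?thesis
  proof (rule localisedI[of _ _ "N + M" "A * D ^ M + B * D ^ N"])
    fix x :: "nat \<Rightarrow> ratfun" assume x: "\<And>i. x i \<in> pos_ratfuns"
    then have "\<And>i. x i \<noteq> 0" by (simp add: pos_ratfuns_nonzero)
    then show "(F x + G x) * laurent_eval x D ^ (N + M) = laurent_eval x (A * D ^ M + B * D ^ N)"
      using A[OF x] B[OF x]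
      by (simp add: laurent_eval_add laurent_eval_mult laurent_eval_power power_add)
        (simp flip: A[OF x] B[OF x] add: algebra_simps)
  qed
qed

lemma localised_mult:
  assumes "localised D F" "localised D G"
  shows "localised D (\<lambda>x. F x * G x)"
proof -
  obtain N A where A: "\<And>x. (\<And>i. x i \<in> pos_ratfuns) \<Longrightarrow> F x * laurent_eval x D ^ N = laurent_eval x A"
    using assms(1) unfolding localised_def by blast
  obtain M B where B: "\<And>x. (\<And>i. x i \<in> pos_ratfuns) \<Longrightarrow> G x * laurent_eval x D ^ M = laurent_eval x B"
    using assms(2) unfolding localised_def by blast
  show ?thesis
  proof (rule localisedI[of _ _ "N + M" "A * B"])
    fix x :: "nat \<Rightarrow> ratfun" assume x: "\<And>i. x i \<in> pos_ratfuns"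
    then have "\<And>i. x i \<noteq> 0" by (simp add: pos_ratfuns_nonzero)
    then show "F x * G x * laurent_eval x D ^ (N + M) = laurent_eval x (A * B)"
      by (simp add: laurent_eval_mult power_add flip: A[OF x] B[OF x])
  qed
qed

lemma localised_power: "localised D F \<Longrightarrow> localised D (\<lambda>x. F x ^ n)"
  using localised_const[of D 1] by (induction n) (simp_all add: localised_mult)

lemma localised_power_int:
  assumes "localised D F" "localised D (\<lambda>x. inverse (F x))"
  shows "localised D (\<lambda>x. F x powi k)"
  using assms by (cases "k \<ge> 0") (simp_all add: power_int_def localised_power)

lemma localised_prod: "(\<And>i. localised D (F i)) \<Longrightarrow> localised D (\<lambda>x. \<Prod>i\<in>A. F i x)"
  using localised_const[of D 1]
  by (induction A rule: infinite_finite_induct) (simp_all add: localised_mult)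

lemma localised_sum: "(\<And>i. localised D (F i)) \<Longrightarrow> localised D (\<lambda>x. \<Sum>i\<in>A. F i x)"
  using localised_const[of D 0]
  by (induction A rule: infinite_finite_induct) (simp_all add: localised_add)

text \<open>Turns an expansion in a mutated cluster \<open>u x\<close> into one in \<open>x\<close>;
  its negative exponents call for the inverses of the coordinates.\<close>

lemma localised_compose:
  assumes "\<And>i. localised D (\<lambda>x. u x i)" "\<And>i. localised D (\<lambda>x. inverse (u x i))"
  shows "localised D (\<lambda>x. laurent_eval (u x) p)"
  unfolding laurent_eval_def laurent_lift_def
  by (intro localised_sum localised_mult localised_prod localised_const localised_power_int assms)

lemma localised_inverse:
  assumes "D = g * h" "\<And>x. (\<And>i. x i \<in> pos_ratfuns) \<Longrightarrow> laurent_eval x g \<noteq> 0"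
  shows "localised D (\<lambda>x. inverse (laurent_eval x g))"
  by (rule localisedI[of _ _ 1 h]) (simp add: assms laurent_eval_mult pos_ratfuns_nonzero)

lemma localised_coordinate: "localised D (\<lambda>x. x i)" "localised D (\<lambda>x. inverse (x i))"
  using localised_laurent_eval[of D "monomial (unit_vec i 1)"]
    localised_laurent_eval[of D "monomial (unit_vec i (-1))"] by (simp_all add: power_int_minus)

text \<open>\<open>F\<close> is both \<open>A / P ^ N\<close> and \<open>B / E ^ M\<close>, so
  \<open>A * E ^ M = B * P ^ N\<close>; as \<open>P\<close> is prime and does not divide
  \<open>E\<close>, \<open>P ^ N\<close> divides \<open>A\<close>.\<close>

lemma localised_coprime:
  assumes "localised P F" "localised E F"
    and prime: "\<And>f g. P dvd f * g \<Longrightarrow> P dvd f \<or> P dvd g"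
    and "\<not> P dvd E" and nonzero: "\<And>x. (\<And>i. x i \<in> pos_ratfuns) \<Longrightarrow> laurent_eval x P \<noteq> 0"
  shows "\<exists>p. \<forall>x. (\<forall>i. x i \<in> pos_ratfuns) \<longrightarrow> F x = laurent_eval x p"
proof -
  obtain N A where A: "\<And>x. (\<And>i. x i \<in> pos_ratfuns) \<Longrightarrow> F x * laurent_eval x P ^ N = laurent_eval x A"
    using assms(1) unfolding localised_def by blast
  obtain M B where B: "\<And>x. (\<And>i. x i \<in> pos_ratfuns) \<Longrightarrow> F x * laurent_eval x E ^ M = laurent_eval x B"
    using assms(2) unfolding localised_def by blast
  \<comment> \<open>\<open>X\<close> is itself a positive cluster, and the value at \<open>X\<close>
    determines a Laurent polynomial.\<close>
  have "laurent_eval X (A * E ^ M) = laurent_eval X (B * P ^ N)"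
    by (simp add: laurent_eval_mult laurent_eval_power X_nonzero pos_ratfuns_X flip: A B)
  then have "A * E ^ M = B * P ^ N"
    using laurent_eval_X_inj by (simp add: inj_eq)
  then have "P ^ N dvd A * E ^ M" by simp
  moreover have "\<not> P dvd E ^ M"
  proof (induction M)
    case 0
    \<comment> \<open>If \<open>P\<close> divided 1, it would divide \<open>E\<close>.\<close>
    show ?case using assms(4) by (metis dvd_mult_left dvd_trans mult_1 one_dvd power_0)
  next
    case (Suc M)
    then show ?case using prime[of E "E ^ M"] assms(4) by (metis power_Suc)
  qed
  moreover have "P \<noteq> 0"
    using nonzero[OF pos_ratfuns_X] by (auto simp: laurent_eval_def)
  ultimately have "P ^ N dvd A" using prime_power_dvd_cancel[OF prime] by blast
  then obtain A' where A': "A = P ^ N * A'" by (auto elim: dvdE)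
  show ?thesis
  proof (intro exI[of _ A'] allI impI)
    fix x :: "nat \<Rightarrow> ratfun" assume x: "\<forall>i. x i \<in> pos_ratfuns"
    then have "F x * laurent_eval x P ^ N = laurent_eval x A' * laurent_eval x P ^ N"
      using A by (simp add: A' laurent_eval_mult laurent_eval_power pos_ratfuns_nonzero)
    then show "F x = laurent_eval x A'" using nonzero x by simp
  qed
qed

section \<open>Three successive mutations\<close>

lemma vec_fun_upd:
  assumes "finite V" "k \<in> V"
  shows "vec V f = vec V (f(k := 0)) + unit_vec k (f k)"
  using assms by (intro poly_mapping_eqI) (auto simp: lookup_vec lookup_add lookup_single when_def)

locale three_mutations =
  fixes V :: "nat set" and b :: "nat \<Rightarrow> nat \<Rightarrow> int" and j k y :: nat
  assumes finite_V: "finite V" and skew: "skew_on V b"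
    and in_V: "j \<in> V" "k \<in> V" "y \<in> V" and distinct: "j \<noteq> k" "y \<noteq> j" "y \<noteq> k"
    and nonneg: "b j k \<ge> 0" and coeff: "b y j = 1" "b y k = 0"
begin

text \<open>
  \<open>P / x_j\<close>, \<open>Z\<close> and \<open>W\<close> are the new cluster variables of the successive mutations at \<open>j\<close>, \<open>k\<close> and
  \<open>j\<close>, expanded in the initial cluster. The last exchange relation reads
  \<open>P * W = x_j * (monomial a2 + Z ^ c * monomial a1)\<close>. Modulo \<open>P\<close>, for \<open>c > 0\<close>, \<open>Z\<close> is the monomial \<open>Z0\<close>;
  with \<open>Z0\<close> in place of \<open>Z\<close> the right-hand side is \<open>P\<close> times a monomial, the first summand of
  \<open>W\<close>. The second one comes from \<open>Z ^ c - Z0 ^ c\<close>, factored through \<open>Z - Z0\<close>.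
\<close>

definition "c = nat (b j k)"
definition "b1 = mutate_matrix j b"
definition "b2 = mutate_matrix k b1"
definition "P = exchange_poly V b j"
definition "n1 = vec V (\<lambda>i. max 0 (b1 i k))"
definition "n2 = vec V ((\<lambda>i. max 0 (- b1 i k))(j := 0))"
definition "a1 = vec V ((\<lambda>i. max 0 (- b2 i j))(k := 0))"
definition "a2 = vec V (\<lambda>i. max 0 (b2 i j))"
definition "p1 = vec V (\<lambda>i. max 0 (b i j))"
definition "p2 = vec V (\<lambda>i. max 0 (- b i j))"
definition "Z0 = monomial (n1 + unit_vec k (-1))"
definition "Z = Z0 + P ^ c * monomial (n2 + unit_vec j (- int c) + unit_vec k (-1))"
definition "W = (if c = 0 then monomial (unit_vec j 1) else
  monomial (unit_vec j 1 + a1 + frag_cmul (int c) (n1 + unit_vec k (-1)) - p1) +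
  monomial (n2 + unit_vec j (1 - int c) + unit_vec k (-1) + a1) * P ^ (c - 1) *
    (\<Sum>i<c. Z0 ^ (c - Suc i) * Z ^ i))"

text \<open>After the mutation at \<open>j\<close> the \<open>c\<close> arrows run from
  \<open>k\<close> to \<open>j\<close>, so away from \<open>k\<close> the mutation at
  \<open>k\<close> changes column \<open>j\<close> only by the paths
  \<open>i -> k -> j\<close>.\<close>

lemma b_values:
  "b j k = int c" "b k j = - int c" "b1 j k = - int c" "b1 k j = int c" "b2 j k = int c" "b2 k j = - int c"
  "b1 k k = 0" "b2 j j = 0" "b j j = 0" "b1 y k = int c"
  "i \<noteq> k \<Longrightarrow> b2 i j = - b i j + int c * max 0 (b1 i k)"
proof -
  have skew1: "skew_on V b1" unfolding b1_def by (rule skew_on_mutate) (rule skew)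
  have skew2: "skew_on V b2" unfolding b2_def by (rule skew_on_mutate) (rule skew1)
  show bjk: "b j k = int c" using nonneg by (simp add: c_def)
  then show bkj: "b k j = - int c" using skew_on_sym[OF skew, of k j] by simp
  show b1jk: "b1 j k = - int c" "b1 k j = int c"
    by (simp_all add: b1_def mutate_matrix_def bjk bkj)
  then show "b2 j k = int c" "b2 k j = - int c"
    by (simp_all add: b2_def mutate_matrix_def)
  show "b1 k k = 0" "b2 j j = 0" "b j j = 0"
    by (rule skew_on_diag[OF skew1] skew_on_diag[OF skew2] skew_on_diag[OF skew])+
  show "b1 y k = int c"
    using distinct by (simp add: b1_def mutate_matrix_def coeff bjk)
  assume "i \<noteq> k"
  moreover have "b1 i j = - b i j" by (simp add: b1_def mutate_matrix_def)
  ultimately show "b2 i j = - b i j + int c * max 0 (b1 i k)"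
    using distinct by (simp add: b2_def mutate_matrix_def b1jk)
qed

lemma P_eq: "P = monomial p1 + monomial p2"
  by (simp add: P_def exchange_poly_def p1_def p2_def)

lemmas lookups = lookup_add lookup_minus lookup_vec[OF finite_V] lookup_single when_def

text \<open>Away from \<open>k\<close>, \<open>a2 - a1\<close> is column \<open>j\<close> of
  \<open>b2\<close> and \<open>p1 - p2\<close> is that of \<open>b\<close>. At \<open>k\<close> the
  exponent \<open>c\<close> in \<open>p2\<close> cancels against the denominator of
  \<open>Z0 ^ c\<close>.\<close>

lemma a2_eq: "p2 + a1 + frag_cmul (int c) (n1 + unit_vec k (-1)) - p1 = a2"
proof (rule poly_mapping_eqI)
  fix i
  show "Poly_Mapping.lookup (p2 + a1 + frag_cmul (int c) (n1 + unit_vec k (-1)) - p1) i = Poly_Mapping.lookup a2 i"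
  proof (cases "i = k")
    case True
    then show ?thesis
      using in_V by (simp add: p1_def p2_def a1_def a2_def n1_def lookups b_values)
  next
    case False
    then show ?thesis
      using b_values(11)[OF False] by (simp add: p1_def p2_def a1_def a2_def n1_def lookups max_def)
  qed
qed

lemma P_mult_W: "P * W = monomial (unit_vec j 1) * (monomial a2 + Z ^ c * monomial a1)"
proof (cases "c = 0")
  \<comment> \<open>Without arrows between \<open>j\<close> and \<open>k\<close>, the mutation at
    \<open>k\<close> does not affect the exchange relation at \<open>j\<close>, so the third
    mutation undoes the first.\<close>
  case True
  have "a1 = p1"
  proof (rule poly_mapping_eqI)
    fix i show "Poly_Mapping.lookup a1 i = Poly_Mapping.lookup p1 i"
      using b_values(2,11) True by (cases "i = k") (simp_all add: a1_def p1_def lookups)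
  qed
  moreover have "a2 = p2" using a2_eq True calculation by simp
  ultimately show ?thesis using True by (simp add: W_def P_eq mult.commute add.commute)
next
  case False
  let ?t = "unit_vec j 1 + a1 + frag_cmul (int c) (n1 + unit_vec k (-1)) - p1"
  let ?s = "n2 + unit_vec j (1 - int c) + unit_vec k (-1) + a1"
  have "P * monomial ?t = monomial (unit_vec j 1 + a1) * Z0 ^ c + monomial (unit_vec j 1) * monomial a2"
    by (simp add: P_eq Z0_def monomial_power mult_single distrib_right flip: a2_eq)
      (simp add: algebra_simps)
  moreover have "P * (monomial ?s * P ^ (c - 1) * (\<Sum>i<c. Z0 ^ (c - Suc i) * Z ^ i)) =
      monomial (unit_vec j 1 + a1) * (Z ^ c - Z0 ^ c)"
  proof -
    have "unit_vec j (1 - int c) = unit_vec j 1 + unit_vec j (- int c)"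
      by (simp flip: single_add)
    then have s: "monomial ?s = monomial (unit_vec j 1 + a1) * monomial (n2 + unit_vec j (- int c) + unit_vec k (-1))"
      by (simp add: mult_single algebra_simps)
    have "P * (monomial ?s * P ^ (c - 1) * (\<Sum>i<c. Z0 ^ (c - Suc i) * Z ^ i)) =
        P ^ Suc (c - 1) * monomial ?s * (\<Sum>i<c. Z0 ^ (c - Suc i) * Z ^ i)"
      by (simp add: mult_ac)
    \<comment> \<open>As \<open>c > 0\<close>, the power of \<open>P\<close> is
      \<open>P ^ c\<close>; with the second monomial factor in \<open>s\<close> it gives
      \<open>Z - Z0\<close>.\<close>
    also have "\<dots> = monomial (unit_vec j 1 + a1) * ((Z - Z0) * (\<Sum>i<c. Z0 ^ (c - Suc i) * Z ^ i))"
      using False unfolding s by (simp add: Z_def mult_ac)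
    also have "\<dots> = monomial (unit_vec j 1 + a1) * (Z ^ c - Z0 ^ c)"
      by (simp add: power_diff_sumr2)
    finally show ?thesis .
  qed
  ultimately have "P * W = monomial (unit_vec j 1 + a1) * Z0 ^ c + monomial (unit_vec j 1) * monomial a2
      + monomial (unit_vec j 1 + a1) * (Z ^ c - Z0 ^ c)"
    using False by (simp add: W_def distrib_left)
  also have "\<dots> = monomial (unit_vec j 1) * (monomial a2 + Z ^ c * monomial a1)"
    by (simp add: algebra_simps flip: monomial_mult)
  finally show ?thesis .
qed

text \<open>The power of the variable mutated just before is split off. As
  \<open>b1 j k = - int c\<close> and \<open>b2 k j = - int c\<close>, it sits in the outgoing
  monomial.\<close>

lemma exchange_polys:
  "exchange_poly V b1 k = monomial n1 + monomial n2 * monomial (unit_vec j (int c))"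
  "exchange_poly V b2 j = monomial a2 + monomial a1 * monomial (unit_vec k (int c))"
  using in_V vec_fun_upd[OF finite_V in_V(1), of "\<lambda>i. max 0 (- b1 i k)"]
    vec_fun_upd[OF finite_V in_V(2), of "\<lambda>i. max 0 (- b2 i j)"]
  by (simp_all add: exchange_poly_def n1_def n2_def a1_def a2_def b_values mult_single)

lemma exponents_free:
  "exponents_in j {0} (monomial n1)" "exponents_in j {0} (monomial n2)"
  "exponents_in j {0} (monomial a1)" "exponents_in j {0} (monomial a2)"
  "exponents_in k {0} (monomial a1)" "exponents_in k {0} (monomial a2)"
  using distinct by (auto simp: n1_def n2_def a1_def a2_def lookups b_values intro!: exponents_in_single)

text \<open>The monomials left after splitting do not involve the changed variables and can be
  evaluated at \<open>x\<close>; the second equation is \<open>P_mult_W\<close> divided by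
  \<open>P\<close>.\<close>

lemma mutated_values:
  assumes x: "\<And>i. x i \<in> pos_ratfuns"
  defines "x1 \<equiv> x(j := laurent_eval x P / x j)"
  shows "laurent_eval x1 (exchange_poly V b1 k) / x1 k = laurent_eval x Z"
    and "laurent_eval (x1(k := laurent_eval x Z)) (exchange_poly V b2 j) / x1 j = laurent_eval x W"
proof -
  have nz: "x i \<noteq> 0" for i using x by (simp add: pos_ratfuns_nonzero)
  have P_nz: "laurent_eval x P \<noteq> 0"
    unfolding P_def using x finite_V by (intro pos_ratfuns_nonzero pos_ratfuns_exchange_poly)
  have x1: "x1 i \<in> pos_ratfuns" for i
    unfolding x1_def P_def using x finite_V by (simp add: pos_ratfuns_divide pos_ratfuns_exchange_poly)
  then have nz1: "x1 i \<noteq> 0" for i by (simp add: pos_ratfuns_nonzero)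
  have free: "laurent_eval x1 r = laurent_eval x r" if "exponents_in j {0} r" for r
    using that by (simp add: x1_def laurent_eval_fun_upd)
  have x1_j: "x1 j = laurent_eval x P / x j" and x1_k: "x1 k = x k"
    using distinct by (simp_all add: x1_def)
  show z: "laurent_eval x1 (exchange_poly V b1 k) / x1 k = laurent_eval x Z"
    unfolding exchange_polys laurent_eval_add laurent_eval_mult[OF nz1] Z_def Z0_def
      monomial_mult[symmetric] laurent_eval_mult[OF nz] laurent_eval_power[OF nz] laurent_eval_unit_vec
    by (simp add: free exponents_free x1_j x1_k power_int_minus power_divide add_divide_distrib)
      (simp add: divide_inverse)
  have "laurent_eval x1 (exchange_poly V b1 k) \<noteq> 0"
    using x1 finite_V by (intro pos_ratfuns_nonzero pos_ratfuns_exchange_poly)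
  then have Z_nz: "laurent_eval x Z \<noteq> 0" using z nz1[of k] by auto
  define x2 where "x2 = x1(k := laurent_eval x Z)"
  have nz2: "x2 i \<noteq> 0" for i using nz1 Z_nz by (simp add: x2_def)
  have x2_k: "x2 k = laurent_eval x Z" by (simp add: x2_def)
  have "laurent_eval x2 (monomial a1) = laurent_eval x (monomial a1)"
    "laurent_eval x2 (monomial a2) = laurent_eval x (monomial a2)"
    by (simp_all only: x2_def laurent_eval_fun_upd free exponents_free)
  then have "laurent_eval x2 (exchange_poly V b2 j) =
      laurent_eval x (monomial a2 + Z ^ c * monomial a1)"
    unfolding exchange_polys laurent_eval_add laurent_eval_mult[OF nz2]
      laurent_eval_mult[OF nz] laurent_eval_power[OF nz] laurent_eval_unit_vec
    by (simp add: x2_k)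
  moreover have "laurent_eval x P * laurent_eval x W = x j * laurent_eval x (monomial a2 + Z ^ c * monomial a1)"
    using arg_cong[OF P_mult_W, of "laurent_eval x"] by (simp add: laurent_eval_mult nz)
  ultimately show "laurent_eval (x1(k := laurent_eval x Z)) (exchange_poly V b2 j) / x1 j = laurent_eval x W"
    unfolding x2_def[symmetric] using P_nz nz[of j] by (simp add: x1_j divide_simps mult.commute)
qed

text \<open>A zero of \<open>P\<close> at which \<open>Z\<close> and \<open>W\<close> do not vanish. If \<open>x_j\<close> were \<open>1\<close>, then \<open>W\<close> could vanish for \<open>c = 1\<close>.\<close>

definition \<psi> :: "nat \<Rightarrow> rat" where
  "\<psi> = (\<lambda>_. 1)(j := 2, y := -1)"

lemma \<psi>_nonzero: "\<psi> i \<noteq> 0"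
  by (simp add: \<psi>_def)

lemma \<psi>_monomial:
  "laurent_eval \<psi> (monomial m) = 2 powi Poly_Mapping.lookup m j * (-1) powi Poly_Mapping.lookup m y"
proof -
  have "laurent_eval \<psi> (monomial m) =
      (\<Prod>i\<in>{j, y} \<union> Poly_Mapping.keys m. \<psi> i powi Poly_Mapping.lookup m i)"
    by (rule laurent_eval_monomial[OF \<psi>_nonzero]) auto
  also have "\<dots> = (\<Prod>i\<in>{j, y}. \<psi> i powi Poly_Mapping.lookup m i)"
    by (rule prod.mono_neutral_right) (auto simp: \<psi>_def)
  finally show ?thesis using distinct by (simp add: \<psi>_def)
qed

text \<open>\<open>y\<close> occurs to the first power in one monomial of \<open>P\<close> and not
  in the other, \<open>x_j\<close> in neither; the values are -1 and 1.\<close>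

lemma \<psi>_P: "laurent_eval \<psi> P = 0"
  using in_V by (simp add: P_eq laurent_eval_add \<psi>_monomial p1_def p2_def lookups b_values coeff)

lemma \<psi>_dvd: "P dvd f \<Longrightarrow> laurent_eval \<psi> f = 0"
  by (auto elim!: dvdE simp: laurent_eval_mult \<psi>_nonzero \<psi>_P)

lemma sign_power_int: "(-1 :: rat) powi i = 1 \<or> (-1 :: rat) powi i = -1"
  by (cases "even i") auto

text \<open>For \<open>c > 0\<close> the second summand of \<open>Z\<close> vanishes with
  \<open>P\<close> and a monomial remains; for \<open>c = 0\<close> both summands have value
  1.\<close>

lemma P_not_dvd_Z: "\<not> P dvd Z"
proof
  assume "P dvd Z"
  then have *: "laurent_eval \<psi> Z = 0" by (rule \<psi>_dvd)
  show False
  proof (cases "c = 0")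
    case True
    have "laurent_eval \<psi> Z = 2"
      using in_V distinct True
      by (simp add: Z_def Z0_def laurent_eval_add \<psi>_monomial n1_def n2_def lookups b_values)
    with * show False by simp
  next
    case False
    then have "laurent_eval \<psi> Z = laurent_eval \<psi> Z0"
      by (simp add: Z_def laurent_eval_add laurent_eval_mult laurent_eval_power \<psi>_nonzero \<psi>_P)
    with * show False by (simp add: Z0_def laurent_eval_monomial_nonzero \<psi>_nonzero)
  qed
qed

lemma P_not_dvd_W: "\<not> P dvd W"
proof
  assume "P dvd W"
  then have *: "laurent_eval \<psi> W = 0" by (rule \<psi>_dvd)
  show False
  proof (cases "c = 0")
    case True
    with * show False by (simp add: W_def \<psi>_nonzero)
  next
    case False
    let ?t = "unit_vec j 1 + a1 + frag_cmul (int c) (n1 + unit_vec k (-1)) - p1"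
    let ?s = "n2 + unit_vec j (1 - int c) + unit_vec k (-1) + a1"
    have t: "laurent_eval \<psi> (monomial ?t) = 2 * (-1) powi Poly_Mapping.lookup ?t y"
      using in_V distinct by (simp add: \<psi>_monomial a1_def n1_def p1_def lookups b_values)
    show False
    \<comment> \<open>For \<open>c = 1\<close> the factor \<open>P ^ (c - 1)\<close> is 1 and both
      summands survive, with values 2 and 1 up to sign. For larger \<open>c\<close> the second one
      vanishes.\<close>
    proof (cases "c = 1")
      case True
      then have s: "laurent_eval \<psi> (monomial ?s) = (-1) powi Poly_Mapping.lookup ?s y"
        using in_V distinct by (simp add: \<psi>_monomial a1_def n2_def lookups b_values)
      have "W = monomial ?t + monomial ?s" using True by (simp add: W_def)
      with * have "2 * (-1 :: rat) powi Poly_Mapping.lookup ?t y + (-1) powi Poly_Mapping.lookup ?s y = 0"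
        unfolding \<open>W = _\<close> laurent_eval_add t s by simp
      with sign_power_int[of "Poly_Mapping.lookup ?t y"] sign_power_int[of "Poly_Mapping.lookup ?s y"]
      show False by (elim disjE) simp_all
    next
      case False
      with \<open>c \<noteq> 0\<close> have "laurent_eval \<psi> P ^ (c - 1) = 0" by (simp add: \<psi>_P)
      then have "laurent_eval \<psi> W = laurent_eval \<psi> (monomial ?t)"
        using \<open>c \<noteq> 0\<close>
        by (simp add: W_def laurent_eval_add laurent_eval_mult laurent_eval_power \<psi>_nonzero del: power_eq_0_iff)
      with * show False by (simp add: laurent_eval_monomial_nonzero \<psi>_nonzero)
    qed
  qed
qed

lemma P_prime: "P dvd f * g \<Longrightarrow> P dvd f \<or> P dvd g"
proof (rule linear_binomial_prime)
  show "P = monomial (unit_vec y 1 + vec V ((\<lambda>i. max 0 (b i j))(y := 0))) + monomial p2"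
    unfolding P_eq p1_def using vec_fun_upd[OF finite_V in_V(3), of "\<lambda>i. max 0 (b i j)"] coeff
    by (simp add: add.commute)
qed (simp_all add: lookups p2_def coeff)

end

section \<open>The Laurent phenomenon\<close>

text \<open>One \<open>q\<close> serves all positive initial clusters, so it may be evaluated at
  mutated ones.\<close>

definition laurent_along :: "nat set \<Rightarrow> (nat \<Rightarrow> nat \<Rightarrow> int) \<Rightarrow> nat list \<Rightarrow> bool" where
  "laurent_along V b p \<longleftrightarrow> (\<forall>i. \<exists>q. \<forall>x. (\<forall>i. x i \<in> pos_ratfuns) \<longrightarrow>
     snd (mutate_along V p (b, x)) i = laurent_eval x q)"

lemma laurent_along_uminus: "laurent_along V (\<lambda>i k. - b i k) p \<longleftrightarrow> laurent_along V b p"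
  by (simp add: laurent_along_def mutate_along_uminus)

context three_mutations
begin

lemma P_nonzero:
  assumes "\<And>i. x i \<in> pos_ratfuns"
  shows "laurent_eval x P \<noteq> 0"
  unfolding P_def using assms finite_V by (intro pos_ratfuns_nonzero pos_ratfuns_exchange_poly)

text \<open>The expansion after \<open>j\<close> shows that \<open>F\<close> is localised at
  \<open>P\<close>, the one after \<open>j, k, j\<close> that it is localised at
  \<open>Z * W\<close>; \<open>localised_coprime\<close> combines them.\<close>

lemma laurent_along_step:
  assumes p1: "laurent_along V (mutate_matrix j b) (k # p)"
    and p3: "laurent_along V (mutate_matrix j (mutate_matrix k (mutate_matrix j b))) (j # p)"
  shows "laurent_along V b (j # k # p)"
  unfolding laurent_along_def
proof
  fix i
  define F where "F = (\<lambda>x. snd (mutate_along V (j # k # p) (b, x)) i)"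
  define x1 :: "(nat \<Rightarrow> ratfun) \<Rightarrow> nat \<Rightarrow> ratfun"
    where "x1 = (\<lambda>x. x(j := laurent_eval x P / x j))"
  define x2 where "x2 = (\<lambda>x. (x1 x)(k := laurent_eval x Z))"
  define x3 where "x3 = (\<lambda>x. (x2 x)(j := laurent_eval x W))"
  have mut1: "mutate V j (b, x) = (b1, x1 x)" for x
    by (simp add: mutate_def x1_def b1_def P_def)
  have mut2: "mutate V k (b1, x1 x) = (b2, x2 x)" if "\<And>i. x i \<in> pos_ratfuns" for x
    using mutated_values(1)[of x, OF that] by (simp add: mutate_def x1_def x2_def b2_def)
  have mut3: "mutate V j (b2, x2 x) = (mutate_matrix j b2, x3 x)" if "\<And>i. x i \<in> pos_ratfuns" for x
    using mutated_values(2)[of x, OF that] distinct by (simp add: mutate_def x1_def x2_def x3_def)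
  have pos1: "x1 x i \<in> pos_ratfuns" if "\<And>i. x i \<in> pos_ratfuns" for x i
    using mutate_pos[OF finite_V, of x j b] that by (simp add: mut1)
  have pos2: "x2 x i \<in> pos_ratfuns" if "\<And>i. x i \<in> pos_ratfuns" for x i
    using mutate_pos[OF finite_V, of "x1 x" k b1] pos1 that by (simp add: mut2)
  have pos3: "x3 x i \<in> pos_ratfuns" if "\<And>i. x i \<in> pos_ratfuns" for x i
    using mutate_pos[OF finite_V, of "x2 x" j b2] pos2 that by (simp add: mut3)
  have Z_nonzero: "laurent_eval x Z \<noteq> 0" if "\<And>i. x i \<in> pos_ratfuns" for x
    using pos_ratfuns_nonzero[OF pos2[of x k, OF that]] by (simp add: x2_def)
  have W_nonzero: "laurent_eval x W \<noteq> 0" if "\<And>i. x i \<in> pos_ratfuns" for x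
    using pos_ratfuns_nonzero[OF pos3[of x j, OF that]] by (simp add: x3_def)
  have skew2: "skew_on V b2"
    unfolding b2_def b1_def by (intro skew_on_mutate skew)

  have "localised P F"
  proof -
    obtain q where q: "\<And>x. (\<And>i. x i \<in> pos_ratfuns) \<Longrightarrow> snd (mutate_along V (k # p) (b1, x)) i = laurent_eval x q"
      using p1 unfolding laurent_along_def b1_def by blast
    \<comment> \<open>The only new coordinate is \<open>P / x_j\<close>, and only its inverse needs
      the denominator \<open>P\<close>.\<close>
    have "localised P (\<lambda>x. laurent_eval (x1 x) q)"
    proof (rule localised_compose)
      fix i
      have "localised P (\<lambda>x. laurent_eval x P * inverse (x j))"
        by (intro localised_mult localised_laurent_eval localised_coordinate)
      then show "localised P (\<lambda>x. x1 x i)"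
        using localised_coordinate by (cases "i = j") (simp_all add: x1_def divide_inverse)
      have "localised P (\<lambda>x. inverse (laurent_eval x P) * x j)"
        by (intro localised_mult localised_inverse[of _ _ 1] localised_coordinate) (simp_all add: P_nonzero)
      then show "localised P (\<lambda>x. inverse (x1 x i))"
        using localised_coordinate by (cases "i = j") (simp_all add: x1_def divide_inverse)
    qed
    then show ?thesis
      by (rule localised_cong) (simp add: F_def mut1 q[symmetric] pos1)
  qed
  moreover have "localised (Z * W) F"
  proof -
    obtain q where q: "\<And>x. (\<And>i. x i \<in> pos_ratfuns) \<Longrightarrow>
        snd (mutate_along V (j # p) (mutate_matrix j b2, x)) i = laurent_eval x q"
      using p3 unfolding laurent_along_def b1_def b2_def by blast
    \<comment> \<open>All coordinates are Laurent: \<open>W\<close> at \<open>j\<close>,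
      \<open>Z\<close> at \<open>k\<close>, the old ones elsewhere. Only the inverses of
      \<open>Z\<close> and \<open>W\<close> need denominators.\<close>
    have "localised (Z * W) (\<lambda>x. laurent_eval (x3 x) q)"
    proof (rule localised_compose)
      fix i
      show "localised (Z * W) (\<lambda>x. x3 x i)"
        using localised_coordinate localised_laurent_eval
        by (cases "i = j"; cases "i = k") (simp_all add: x3_def x2_def x1_def)
      have "localised (Z * W) (\<lambda>x. inverse (laurent_eval x Z))"
        "localised (Z * W) (\<lambda>x. inverse (laurent_eval x W))"
        by (rule localised_inverse[of _ _ W]; simp add: Z_nonzero)
          (rule localised_inverse[of _ _ Z]; simp add: W_nonzero mult.commute)
      then show "localised (Z * W) (\<lambda>x. inverse (x3 x i))"
        using localised_coordinate
        by (cases "i = j"; cases "i = k") (simp_all add: x3_def x2_def x1_def)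
    qed
    then show ?thesis
    proof (rule localised_cong)
      fix x :: "nat \<Rightarrow> ratfun" assume x: "\<And>i. x i \<in> pos_ratfuns"
      \<comment> \<open>The first step of \<open>j # p\<close> undoes the third mutation, after
        which \<open>p\<close> continues from the seed after \<open>j\<close> and
        \<open>k\<close>.\<close>
      have "mutate V j (mutate_matrix j b2, x3 x) = (b2, x2 x)"
        using mutate_involution[OF finite_V skew2, of "x2 x" j] pos2[of x, OF x] by (simp add: mut3 x)
      then show "laurent_eval (x3 x) q = F x"
        using q[of "x3 x"] pos3[of x, OF x] by (simp add: F_def mut1 mut2 x)
    qed
  qed
  ultimately show "\<exists>q. \<forall>x. (\<forall>i. x i \<in> pos_ratfuns) \<longrightarrow> snd (mutate_along V (j # k # p) (b, x)) i = laurent_eval x q"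
    unfolding F_def using P_prime P_not_dvd_Z P_not_dvd_W P_nonzero
    by (intro localised_coprime[of P _ "Z * W"]) blast+
qed

end

section \<open>Adjoining a frozen vertex\<close>

text \<open>\<open>y\<close> is never mutated, so the matrix entries within \<open>V\<close> evolve
  without it, and its value 1 only adds trivial factors to the exchange monomials.\<close>

lemma mutate_along_frozen:
  assumes "finite V" "y \<notin> V" "set p \<subseteq> V" "i \<in> V"
    and "\<And>i k. i \<in> V \<Longrightarrow> k \<in> V \<Longrightarrow> b' i k = b i k"
    and "\<And>i. i \<in> V \<Longrightarrow> x' i = x i" "x' y = 1"
    and "\<And>i. x i \<in> pos_ratfuns" "\<And>i. x' i \<in> pos_ratfuns"
  shows "snd (mutate_along (insert y V) p (b', x')) i = snd (mutate_along V p (b, x)) i"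
  using assms(3,5-)
proof (induction p arbitrary: b b' x x')
  case Nil
  then show ?case using assms(4) by simp
next
  case (Cons j p)
  define z where "z = snd (mutate V j (b, x))"
  define z' where "z' = snd (mutate (insert y V) j (b', x'))"
  have j: "j \<in> V" "j \<noteq> y" using Cons.prems(1) assms(2) by auto
  have "laurent_eval x' (exchange_poly (insert y V) b' j) = laurent_eval x (exchange_poly V b j)"
  proof -
    have "(\<Prod>i\<in>V. x' i powi f (b' i j)) = (\<Prod>i\<in>V. x i powi f (b i j))" for f
      using j by (intro prod.cong refl) (simp add: Cons.prems(2,3))
    then show ?thesis
      using assms(1,2) Cons.prems(4)
      by (simp add: laurent_eval_exchange_poly pos_ratfuns_nonzero Cons.prems(5,6))
  qed
  then have z: "z' i = z i" if "i \<in> V" for i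
    using that j Cons.prems(3) by (simp add: z_def z'_def mutate_def)
  have "snd (mutate_along (insert y V) p (mutate_matrix j b', z')) i
      = snd (mutate_along V p (mutate_matrix j b, z)) i"
  proof (rule Cons.IH)
    show "set p \<subseteq> V" using Cons.prems(1) by simp
    show "mutate_matrix j b' i k = mutate_matrix j b i k" if "i \<in> V" "k \<in> V" for i k
      using that j Cons.prems(2) by (simp add: mutate_matrix_def)
    show "z' i = z i" if "i \<in> V" for i using that by (rule z)
    show "z' y = 1" using j Cons.prems(4) by (simp add: z'_def mutate_def)
    show "z i \<in> pos_ratfuns" for i
      unfolding z_def by (rule mutate_pos) (simp_all add: assms(1) Cons.prems(5))
    show "z' i \<in> pos_ratfuns" for i
      unfolding z'_def by (rule mutate_pos) (simp_all add: assms(1) Cons.prems(6))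
  qed
  moreover have "mutate V j (b, x) = (mutate_matrix j b, z)"
    and "mutate (insert y V) j (b', x') = (mutate_matrix j b', z')"
    by (simp_all add: z_def z'_def mutate_def)
  ultimately show ?case by simp
qed

lemma mutate_along_outside: "i \<notin> set p \<Longrightarrow> snd (mutate_along V p (b, x)) i = x i"
  by (induction p arbitrary: b x) (simp_all add: mutate_def)

lemma skew_on_uminus: "skew_on V b \<Longrightarrow> skew_on V (\<lambda>i k. - b i k)"
  unfolding skew_on_def by (metis neg_equal_0_iff_equal)

text \<open>\<open>V\<close> and \<open>b\<close> vary in the induction on the path length, because
  each step adjoins a new vertex and passes to mutated matrices.\<close>

theorem laurent_phenomenon:
  assumes "finite V" "skew_on V b" "set p \<subseteq> V"
  shows "laurent_along V b p"
  using assms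
proof (induction "length p" arbitrary: V b p rule: less_induct)
  case less
  consider "p = []" | j where "p = [j]" | j k p' where "p = j # k # p'"
    by (cases p rule: list.exhaust; cases "tl p" rule: list.exhaust) auto
  then show ?case
  proof cases
    case 1
    have "\<exists>q. \<forall>x. (\<forall>i. x i \<in> pos_ratfuns) \<longrightarrow> x i = laurent_eval x q" for i
      by (intro exI[of _ "monomial (unit_vec i 1)"]) simp
    then show ?thesis using 1 by (simp add: laurent_along_def)
  next
    case (2 j)
    have "\<exists>q. \<forall>x. (\<forall>i. x i \<in> pos_ratfuns) \<longrightarrow> snd (mutate V j (b, x)) i = laurent_eval x q" for i
    proof (cases "i = j")
      case True
      then show ?thesis
        by (intro exI[of _ "exchange_poly V b j * monomial (unit_vec j (-1))"])
          (simp add: mutate_def laurent_eval_mult pos_ratfuns_nonzero power_int_minus divide_inverse)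
    next
      case False
      then show ?thesis
        by (intro exI[of _ "monomial (unit_vec i 1)"]) (simp add: mutate_def)
    qed
    then show ?thesis using 2 by (simp add: laurent_along_def)
  next
    case (3 j k p')
    have path: "j \<in> V" "k \<in> V" "set p' \<subseteq> V" using less.prems(3) 3 by auto
    show ?thesis
    proof (cases "j = k")
      case True
      have "laurent_along V b p'"
        using less.hyps[of p' V b] less.prems path 3 by simp
      then show ?thesis
        using True 3 mutate_involution[OF less.prems(1,2)] by (simp add: laurent_along_def)
    next
      case False
      \<comment> \<open>Stated for any such \<open>b\<close>, to serve for the given matrix and for
        its negative.\<close>
      have nonneg_case: "laurent_along V b p" if b: "skew_on V b" "b j k \<ge> 0" for b
        unfolding laurent_along_def
      proof
        fix i
        obtain y where y: "y \<notin> V" using less.prems(1) ex_new_if_finite by blast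
        \<comment> \<open>The new vertex gets a single arrow, into \<open>j\<close>.\<close>
        define b' where "b' = (\<lambda>i k. if i = y \<and> k = j then 1 else if i = j \<and> k = y then -1 else b i k)"
        let ?V = "insert y V"
        have fin: "finite ?V" using less.prems(1) by simp
        have y_distinct: "y \<noteq> j" "y \<noteq> k" using y path by auto
        have skew': "skew_on ?V b'"
          unfolding skew_on_def
        proof (intro conjI allI impI)
          fix i k
          show "b' k i = - b' i k"
            using y_distinct skew_on_sym[OF b(1), of k i] by (auto simp: b'_def)
          assume "b' i k \<noteq> 0"
          then show "i \<in> ?V" "k \<in> ?V"
            using path skew_on_outside[OF b(1), of i k] by (auto simp: b'_def split: if_splits)
        qed
        interpret three_mutations ?V b' j k y
          using fin skew' path y_distinct False b(2) skew_on_outside[OF b(1)] y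
          by unfold_locales (auto simp: b'_def)
        have "laurent_along ?V b' (j # k # p')"
        proof (rule laurent_along_step)
          \<comment> \<open>Both this path and \<open>j # p'\<close> are one step shorter than
            \<open>p\<close>.\<close>
          show "laurent_along ?V (mutate_matrix j b') (k # p')"
            using fin path by (intro less.hyps skew_on_mutate skew') (auto simp: 3)
          show "laurent_along ?V (mutate_matrix j (mutate_matrix k (mutate_matrix j b'))) (j # p')"
            using fin path by (intro less.hyps skew_on_mutate skew') (auto simp: 3)
        qed
        then obtain q where q: "\<And>x. (\<And>i. x i \<in> pos_ratfuns) \<Longrightarrow>
            snd (mutate_along ?V p (b', x)) i = laurent_eval x q"
          unfolding laurent_along_def 3 by blast
        show "\<exists>q. \<forall>x. (\<forall>i. x i \<in> pos_ratfuns) \<longrightarrow> snd (mutate_along V p (b, x)) i = laurent_eval x q"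
        proof (cases "i \<in> V")
          case True
          show ?thesis
          proof (intro exI[of _ "specialise [y \<mapsto> 1] q"] allI impI)
            fix x :: "nat \<Rightarrow> ratfun" assume x: "\<forall>i. x i \<in> pos_ratfuns"
            have x': "(x(y := 1)) i \<in> pos_ratfuns" for i using x by (simp add: pos_ratfuns_1)
            have "snd (mutate_along V p (b, x)) i = snd (mutate_along ?V p (b', x(y := 1))) i"
              using y_distinct y path x x' less.prems(1,3) True
              by (intro mutate_along_frozen[symmetric]) (auto simp: b'_def)
            also have "\<dots> = laurent_eval (x(y := 1)) q" by (rule q) (rule x')
            finally show "snd (mutate_along V p (b, x)) i = laurent_eval x (specialise [y \<mapsto> 1] q)"
              using x by (simp add: laurent_eval_specialise_one pos_ratfuns_nonzero)
          qed
        next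
          case False
          then have "i \<notin> set p" using less.prems(3) by blast
          then show ?thesis
            by (intro exI[of _ "monomial (unit_vec i 1)"]) (simp add: mutate_along_outside)
        qed
      qed
      show ?thesis
      proof (cases "b j k \<ge> 0")
        case True
        then show ?thesis using nonneg_case less.prems(2) by blast
      next
        case False
        then have "laurent_along V (\<lambda>i k. - b i k) p"
          using skew_on_uminus[OF less.prems(2)] by (intro nonneg_case) auto
        then show ?thesis by (simp add: laurent_along_uminus)
      qed
    qed
  qed
qed

section \<open>From quivers to matrices, and the shape of the elements of the cluster
  algebra\<close>

section \<open>Quivers and their matrices\<close>

definition quiver_matrix :: "quiver \<Rightarrow> nat \<Rightarrow> nat \<Rightarrow> int" where
  "quiver_matrix Q = (\<lambda>i k. int (Q i k) - int (Q k i))"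

definition no_2_cycles :: "quiver \<Rightarrow> bool" where
  "no_2_cycles Q \<longleftrightarrow> (\<forall>i k. Q i k = 0 \<or> Q k i = 0)"

lemma max_quiver_matrix:
  assumes "no_2_cycles Q"
  shows "max 0 (quiver_matrix Q i k) = int (Q i k)" "max 0 (- quiver_matrix Q i k) = int (Q k i)"
  using assms[unfolded no_2_cycles_def, rule_format, of i k] by (auto simp: quiver_matrix_def)

text \<open>Cancelling pairs of opposite arrows does not change signed counts; without 2-cycles
  their positive parts are the arrow numbers themselves.\<close>

lemma quiver_matrix_mutate:
  assumes "no_2_cycles Q"
  shows "quiver_matrix (mutate_quiver j Q) = mutate_matrix j (quiver_matrix Q)"
proof (intro ext)
  fix a c
  have "quiver_matrix (mutate_quiver j Q) a c =
      int (reverse_and_complete j Q a c) - int (reverse_and_complete j Q c a)"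
    by (simp add: quiver_matrix_def mutate_quiver_def remove_2_cycles_def)
  also have "\<dots> = mutate_matrix j (quiver_matrix Q) a c"
    unfolding mutate_matrix_def max_quiver_matrix[OF assms]
    by (simp add: reverse_and_complete_def quiver_matrix_def)
  finally show "quiver_matrix (mutate_quiver j Q) a c = mutate_matrix j (quiver_matrix Q) a c" .
qed

lemma no_2_cycles_mutate: "no_2_cycles (mutate_quiver j Q)"
  by (auto simp: no_2_cycles_def mutate_quiver_def remove_2_cycles_def)

lemma laurent_eval_quiver_exchange:
  assumes "no_2_cycles Q" "finite V" "\<And>i. x i \<noteq> 0"
  shows "laurent_eval x (exchange_poly V (quiver_matrix Q) j) =
    (\<Prod>i\<in>V. x i ^ Q i j) + (\<Prod>i\<in>V. x i ^ Q j i)"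
  unfolding laurent_eval_exchange_poly[OF assms(2,3)] max_quiver_matrix[OF assms(1)] by simp

lemma mutate_seed_eq:
  assumes "no_2_cycles Q" "\<And>i. x i \<noteq> 0"
  shows "mutate {1..n} j (quiver_matrix Q, x) =
    (quiver_matrix (fst (mutate_seed n j (Q, x))), snd (mutate_seed n j (Q, x)))"
  by (simp only: mutate_def mutate_seed_def case_prod_conv quiver_matrix_mutate[OF assms(1)]
      laurent_eval_quiver_exchange[OF assms(1) finite_atLeastAtMost assms(2)] fst_conv snd_conv)

lemma mutate_along_pos:
  assumes "finite V" "\<And>i. x i \<in> pos_ratfuns"
  shows "snd (mutate_along V p (b, x)) i \<in> pos_ratfuns"
  using assms(2)
proof (induction p arbitrary: b x)
  case (Cons j p)
  have "snd (mutate V j (b, x)) i \<in> pos_ratfuns" for i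
    by (rule mutate_pos) (simp_all add: assms(1) Cons.prems)
  then have "snd (mutate_along V p (fst (mutate V j (b, x)), snd (mutate V j (b, x)))) i \<in> pos_ratfuns"
    by (rule Cons.IH)
  then show ?case by simp
qed simp

lemma seeds_mutate_along:
  assumes "is_quiver n Q" "s \<in> seeds n Q"
  shows "no_2_cycles (fst s) \<and> (\<exists>p. set p \<subseteq> {1..n} \<and>
    mutate_along {1..n} p (quiver_matrix Q, X) = (quiver_matrix (fst s), snd s))"
  using assms(2)
proof induction
  case initial
  show ?case
    using assms(1) by (auto simp: initial_seed_def no_2_cycles_def is_quiver_def intro: exI[of _ "[]"])
next
  case (mutate s j)
  then obtain p where p: "set p \<subseteq> {1..n}" "no_2_cycles (fst s)"
    "mutate_along {1..n} p (quiver_matrix Q, X) = (quiver_matrix (fst s), snd s)" by blast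
  have pos: "snd s i \<in> pos_ratfuns" for i
    using mutate_along_pos[of "{1..n}" X p "quiver_matrix Q" i] p(3) by (simp add: pos_ratfuns_X)
  have "mutate_along {1..n} (p @ [j]) (quiver_matrix Q, X) =
      (quiver_matrix (fst (mutate_seed n j s)), snd (mutate_seed n j s))"
    using mutate_seed_eq[of "fst s" "snd s" n j] p(2,3) pos by (simp add: pos_ratfuns_nonzero)
  moreover have "no_2_cycles (fst (mutate_seed n j s))"
    by (simp add: mutate_seed_def no_2_cycles_mutate split: prod.split)
  ultimately show ?case using p(1) mutate.hyps by (intro conjI exI[of _ "p @ [j]"]) auto
qed

lemma skew_on_quiver_matrix: "is_quiver n Q \<Longrightarrow> skew_on {1..n} (quiver_matrix Q)"
  unfolding skew_on_def
proof (intro conjI allI impI)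
  fix i k
  assume Q: "is_quiver n Q"
  show "quiver_matrix Q k i = - quiver_matrix Q i k" by (simp add: quiver_matrix_def)
  assume "quiver_matrix Q i k \<noteq> 0"
  then have "Q i k \<noteq> 0 \<or> Q k i \<noteq> 0" by (auto simp: quiver_matrix_def)
  with Q show "i \<in> {1..n}" "k \<in> {1..n}" unfolding is_quiver_def by blast+
qed

section \<open>Expansions in two adjacent clusters\<close>

text \<open>Positive powers of \<open>P / x_j\<close> are multiples of \<open>P\<close> and go into
  \<open>g\<close>. The other powers become nonnegative powers of \<open>x_j\<close> once a power of
  \<open>P\<close> is cleared, and go into \<open>u\<close>.\<close>

lemma adjacent_expansion:
  assumes P: "exponents_in j {0} P" and "P \<noteq> 0"
  shows "\<exists>N g u. exponents_in j {0..} u \<and>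
    laurent_eval (X(j := laurent_eval X P / X j)) q * laurent_eval X P ^ N =
    laurent_eval X (P ^ N * (P * g) + u)"
proof (induction q rule: poly_mapping_single_induct)
  case zero
  show ?case by (intro exI[of _ 0]) (simp add: exponents_in_0 laurent_eval_def)
next
  case (add p q)
  let ?\<xi> = "X(j := laurent_eval X P / X j)"
  from add obtain N g u M g' u' where u: "exponents_in j {0..} u" "exponents_in j {0..} u'" and
    e: "laurent_eval ?\<xi> p * laurent_eval X P ^ N = laurent_eval X (P ^ N * (P * g) + u)"
      "laurent_eval ?\<xi> q * laurent_eval X P ^ M = laurent_eval X (P ^ M * (P * g') + u')" by blast
  have "laurent_eval ?\<xi> (p + q) * laurent_eval X P ^ (N + M) =
      (laurent_eval ?\<xi> p * laurent_eval X P ^ N) * laurent_eval X P ^ M +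
      (laurent_eval ?\<xi> q * laurent_eval X P ^ M) * laurent_eval X P ^ N"
    by (simp add: laurent_eval_add power_add algebra_simps)
  also have "\<dots> = laurent_eval X (P ^ (N + M) * (P * (g + g')) + (P ^ M * u + P ^ N * u'))"
    unfolding e by (simp add: X_nonzero laurent_eval_add laurent_eval_mult laurent_eval_power power_add algebra_simps)
  finally have *: "laurent_eval ?\<xi> (p + q) * laurent_eval X P ^ (N + M) = \<dots>" .
  have "exponents_in j {0..} (P ^ M * u + P ^ N * u')"
  proof -
    have P_pow: "exponents_in j {0} (P ^ M)" for M by (rule exponents_in_power[OF P]) auto
    have P_mult: "exponents_in j {0..} (P ^ M * v)" if "exponents_in j {0..} v" for M v
      by (rule exponents_in_mult[OF P_pow that]) auto
    then show ?thesis by (intro exponents_in_add P_mult u)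
  qed
  with * show ?case by blast
next
  case (single m c)
  have P_nonzero: "laurent_eval X P \<noteq> 0" using assms(2) laurent_eval_X_eq_0 by blast
  let ?\<xi> = "X(j := laurent_eval X P / X j)"
  define k where "k = Poly_Mapping.lookup m j"
  define m0 where "m0 = m - unit_vec j k"
  have m0: "Poly_Mapping.lookup m0 j = 0" by (simp add: m0_def k_def lookup_minus)
  have \<xi>: "?\<xi> i \<noteq> 0" for i using P_nonzero by (simp add: X_nonzero)
  have "Poly_Mapping.single m c = Poly_Mapping.single m0 c * monomial (unit_vec j k)"
    by (simp add: m0_def mult_single)
  then have eval: "laurent_eval ?\<xi> (Poly_Mapping.single m c) =
      laurent_eval X (Poly_Mapping.single m0 c) * (laurent_eval X P / X j) powi k"
    using laurent_eval_mult[of ?\<xi>, OF \<xi>] m0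
    by (simp add: laurent_eval_fun_upd exponents_in_single)
  show ?case
  proof (cases "k > 0")
    case True
    define l where "l = nat k - 1"
    have k: "k = int (Suc l)" using True by (simp add: l_def)
    have "laurent_eval ?\<xi> (Poly_Mapping.single m c) * laurent_eval X P ^ 0 =
        laurent_eval X (P ^ 0 * (P * (Poly_Mapping.single m0 c * P ^ l * monomial (unit_vec j (- k)))) + 0)"
      unfolding eval laurent_eval_mult[of X, OF X_nonzero] laurent_eval_power[of X, OF X_nonzero]
        laurent_eval_unit_vec laurent_eval_add k power_int_minus power_int_of_nat
      by (simp add: laurent_eval_1 X_nonzero field_simps) (simp add: laurent_eval_def)
    then show ?thesis using exponents_in_0 by blast
  next
    case False
    define l where "l = nat (- k)"
    have k: "k = - int l" using False by (simp add: l_def)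
    have "laurent_eval ?\<xi> (Poly_Mapping.single m c) * laurent_eval X P ^ l =
        laurent_eval X (P ^ l * (P * 0) + Poly_Mapping.single m0 c * monomial (unit_vec j (- k)))"
      unfolding eval using P_nonzero
      by (simp add: laurent_eval_mult X_nonzero k power_int_minus field_simps)
    moreover have "exponents_in j {0..} (Poly_Mapping.single m0 c * monomial (unit_vec j (- k)))"
      using False m0 by (simp add: mult_single exponents_in_single lookup_add)
    ultimately show ?thesis by blast
  qed
qed

text \<open>Comparing the initial and the adjacent expansion, \<open>P ^ N * (q - P * g)\<close> is
  polynomial in \<open>x_j\<close>; the factor \<open>P ^ N\<close> is free of \<open>x_j\<close>
  and can be cancelled.\<close>

lemma cluster_variable_expansion:
  assumes V: "finite V" "skew_on V b" "j \<in> V" "set p \<subseteq> V"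
  defines "P \<equiv> exchange_poly V b j"
  shows "\<exists>g u. exponents_in j {0..} u \<and> snd (mutate_along V p (b, X)) i = laurent_eval X (P * g + u)"
proof -
  let ?f = "snd (mutate_along V p (b, X)) i"
  let ?x = "X(j := laurent_eval X P / X j)"
  have P_pos: "laurent_eval X P \<in> pos_ratfuns"
    unfolding P_def by (rule pos_ratfuns_exchange_poly[OF V(1) pos_ratfuns_X])
  then have P_eval: "laurent_eval X P \<noteq> 0" by (rule pos_ratfuns_nonzero)
  then have P_nonzero: "P \<noteq> 0" by (auto simp: laurent_eval_def)
  have P: "exponents_in j {0} P" unfolding P_def by (rule exponents_in_exchange_poly[OF V(1,2)])
  obtain q where q: "?f = laurent_eval X q"
    using laurent_phenomenon[OF V(1,2,4)] pos_ratfuns_X unfolding laurent_along_def by blast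
  have mut: "mutate V j (b, X) = (mutate_matrix j b, ?x)" by (simp add: mutate_def P_def)
  \<comment> \<open>From the seed mutated at \<open>j\<close>, the path \<open>j # p\<close> first
    returns to the initial seed.\<close>
  have "set (j # p) \<subseteq> V" using V by simp
  moreover have "?x i \<in> pos_ratfuns" for i
    using P_pos by (simp add: pos_ratfuns_X pos_ratfuns_divide)
  ultimately obtain q' where "snd (mutate_along V (j # p) (mutate_matrix j b, ?x)) i = laurent_eval ?x q'"
    using laurent_phenomenon[OF V(1) skew_on_mutate[OF V(2)]] unfolding laurent_along_def by blast
  then have q': "?f = laurent_eval ?x q'"
    using mutate_involution[OF V(1,2), of X j] by (simp add: mut pos_ratfuns_X)
  obtain N g u where u: "exponents_in j {0..} u" and
    "laurent_eval ?x q' * laurent_eval X P ^ N = laurent_eval X (P ^ N * (P * g) + u)"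
    using adjacent_expansion[OF P P_nonzero] by blast
  then have "laurent_eval X (q * P ^ N) = laurent_eval X (P ^ N * (P * g) + u)"
    using q q' by (simp add: laurent_eval_mult laurent_eval_power X_nonzero)
  then have "q * P ^ N = P ^ N * (P * g) + u"
    using laurent_eval_X_inj by (simp add: inj_eq)
  then have "P ^ N * (q - P * g) = u" by (simp add: algebra_simps)
  moreover have "exponents_in j {0} (P ^ N)" by (rule exponents_in_power[OF P]) auto
  moreover have "P ^ N \<noteq> 0" using P_nonzero by simp
  ultimately have "exponents_in j {0..} (q - P * g)"
    using u exponents_in_cancel by blast
  moreover have "q = P * g + (q - P * g)" by simp
  ultimately show ?thesis using q by metis
qed

text \<open>The multiples of \<open>P\<close> plus the elements polynomial in \<open>x_j\<close>
  form a ring, so the claim passes from cluster variables to the algebra.\<close>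

lemma cluster_algebra_expansion:
  assumes "is_quiver n Q" "j \<in> {1..n}" "f \<in> cluster_algebra n Q"
  defines "P \<equiv> exchange_poly {1..n} (quiver_matrix Q) j"
  shows "\<exists>g u. exponents_in j {0..} u \<and> f = laurent_eval X (P * g + u)"
  using assms(3) unfolding cluster_algebra_def
proof induction
  case (generator f)
  then obtain s i where s: "s \<in> seeds n Q" "f = snd s i" by (auto simp: cluster_variables_def)
  then show ?case
    using seeds_mutate_along[OF assms(1) s(1)]
      cluster_variable_expansion[OF _ skew_on_quiver_matrix[OF assms(1)] assms(2)]
    unfolding P_def by (metis finite_atLeastAtMost snd_conv)
next
  case one
  show ?case
    by (intro exI[of _ 0] exI[of _ 1]) (simp add: exponents_in_def laurent_eval_1 X_nonzero)
next
  case (diff a c)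
  then obtain g u g' u' where u: "exponents_in j {0..} u" "exponents_in j {0..} u'"
    and "a = laurent_eval X (P * g + u)" "c = laurent_eval X (P * g' + u')" by blast
  then have "a - c = laurent_eval X (P * (g - g') + (u - u'))"
    by (simp add: laurent_eval_diff[symmetric]) (simp add: algebra_simps)
  then show ?case using exponents_in_diff[OF u] by blast
next
  case (mult a c)
  then obtain g u g' u' where u: "exponents_in j {0..} u" "exponents_in j {0..} u'"
    and "a = laurent_eval X (P * g + u)" "c = laurent_eval X (P * g' + u')" by blast
  then have "a * c = laurent_eval X ((P * g + u) * (P * g' + u'))"
    by (simp add: laurent_eval_mult X_nonzero)
  also have "(P * g + u) * (P * g' + u') = P * (P * g * g' + g * u' + u * g') + u * u'"
    by (simp add: algebra_simps)
  finally have "a * c = laurent_eval X \<dots>" .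
  moreover have "exponents_in j {0..} (u * u')"
    by (rule exponents_in_mult[OF u]) auto
  ultimately show ?case by blast
qed

section \<open>Specialisation and the criterion for polyamory\<close>

section \<open>Specialised exchange polynomials\<close>

lemma of_int_eq_single: "(of_int c :: laurent) = Poly_Mapping.single 0 c"
  by (simp flip: single_of_int)

lemma specialise_power_exponents:
  assumes "i \<noteq> j"
  shows "exponents_in j {0} (specialise_power \<sigma> i k)"
proof (cases "\<sigma> i")
  case None
  then show ?thesis using assms
    by (simp add: specialise_power_def exponents_in_single lookup_single)
next
  case (Some a)
  have "specialise_power \<sigma> i k = Poly_Mapping.single 0 (a ^ nat \<bar>k\<bar>)"
    using Some by (simp add: specialise_power_def of_int_eq_single del: of_int_power)
  then show ?thesis by (simp add: exponents_in_single)
qed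

text \<open>The factor of the unlabelled \<open>j\<close> keeps its exponent, and all other factors
  are free of \<open>j\<close>.\<close>

lemma specialise_prod_exponents:
  assumes "\<sigma> j = None"
  shows "exponents_in j {Poly_Mapping.lookup m j}
    (\<Prod>i\<in>Poly_Mapping.keys m. specialise_power \<sigma> i (Poly_Mapping.lookup m i))"
proof -
  have "exponents_in j {if j \<in> A then Poly_Mapping.lookup m j else 0}
      (\<Prod>i\<in>A. specialise_power \<sigma> i (Poly_Mapping.lookup m i))" if "finite A" for A
    using that
  proof (induction A rule: finite_induct)
    case empty
    show ?case by (simp add: exponents_in_def)
  next
    case (insert a A)
    have "exponents_in j {if a = j then Poly_Mapping.lookup m j else 0}
        (specialise_power \<sigma> a (Poly_Mapping.lookup m a))"
      using assms specialise_power_exponents[of a j \<sigma>]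
      by (cases "a = j") (simp_all add: specialise_power_def exponents_in_single lookup_single)
    from exponents_in_mult[OF this insert.IH, of "{if j \<in> insert a A then Poly_Mapping.lookup m j else 0}"]
    show ?case using insert.hyps by (cases "a = j") auto
  qed
  from this[of "Poly_Mapping.keys m"] show ?thesis by (simp add: in_keys_iff split: if_splits)
qed

lemma specialise_exponents:
  assumes "\<sigma> j = None" "exponents_in j A p"
  shows "exponents_in j A (specialise \<sigma> p)"
proof -
  have "exponents_in j A (\<Sum>m\<in>M. of_int (Poly_Mapping.lookup p m) *
      (\<Prod>i\<in>Poly_Mapping.keys m. specialise_power \<sigma> i (Poly_Mapping.lookup m i)))"
    if "M \<subseteq> Poly_Mapping.keys p" for M
    using finite_subset[OF that finite_keys] that
  proof (induction M rule: finite_induct)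
    case empty
    show ?case by (simp add: exponents_in_0)
  next
    case (insert m M)
    have "exponents_in j {0} (of_int c :: laurent)" for c
      by (simp add: of_int_eq_single exponents_in_single)
    from exponents_in_mult[OF this specialise_prod_exponents[where \<sigma> = \<sigma> and j = j and m = m, OF assms(1)]]
    have "exponents_in j A (of_int (Poly_Mapping.lookup p m) *
        (\<Prod>i\<in>Poly_Mapping.keys m. specialise_power \<sigma> i (Poly_Mapping.lookup m i)))"
      using insert.prems assms(2) by (auto simp: exponents_in_def)
    then show ?case using insert by (simp add: exponents_in_add)
  qed
  from this[OF order.refl] show ?thesis by (simp add: specialise_def)
qed

text \<open>The default 1 makes unlabelled vertices neutral in products of signs.\<close>

definition sign_of :: "(nat \<rightharpoonup> int) \<Rightarrow> nat \<Rightarrow> int" where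
  "sign_of \<sigma> i = (case \<sigma> i of None \<Rightarrow> 1 | Some a \<Rightarrow> a)"

lemma specialise_monomial_vec:
  assumes "ran \<sigma> \<subseteq> {1, -1}" "finite V"
  shows "specialise \<sigma> (monomial (vec V (\<lambda>i. int (e i)))) =
    Poly_Mapping.single (vec V (\<lambda>i. if \<sigma> i = None then int (e i) else 0)) (\<Prod>i\<in>V. sign_of \<sigma> i ^ e i)"
proof -
  interpret laurent_substitution "specialise_power \<sigma>"
    by (rule laurent_substitution_specialise) (rule assms)
  have power: "specialise_power \<sigma> i (int k) =
      Poly_Mapping.single (unit_vec i (if \<sigma> i = None then int k else 0)) (sign_of \<sigma> i ^ k)" for i k
  proof (cases "\<sigma> i")
    case (Some a)
    then show ?thesis
      by (simp add: specialise_power_def sign_of_def of_int_eq_single del: of_int_power)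
  qed (simp add: specialise_power_def sign_of_def)
  have "specialise \<sigma> (monomial (vec V (\<lambda>i. int (e i)))) = (\<Prod>i\<in>V. specialise_power \<sigma> i (int (e i)))"
    using prod_superset[OF assms(2) keys_vec[OF assms(2)], of "\<lambda>i. int (e i)"] assms(2)
    by (simp add: specialise_eq laurent_lift_single lookup_vec cong: prod.cong)
  also have "\<dots> = (\<Prod>i\<in>V. Poly_Mapping.single (unit_vec i (if \<sigma> i = None then int (e i) else 0)) (sign_of \<sigma> i ^ e i))"
    by (simp only: power)
  also have "\<dots> = Poly_Mapping.single (vec V (\<lambda>i. if \<sigma> i = None then int (e i) else 0)) (\<Prod>i\<in>V. sign_of \<sigma> i ^ e i)"
    using assms(2) unfolding vec_def
  proof (induction V rule: finite_induct)
    case (insert a V)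
    then show ?case by (simp only: prod.insert sum.insert mult_single not_False_eq_True)
  qed simp
  finally show ?thesis .
qed

lemma single_add_single_eq_0:
  fixes s t :: int
  assumes "s = 1 \<or> s = -1"
  shows "Poly_Mapping.single m s + Poly_Mapping.single m' t = 0 \<longleftrightarrow> m = m' \<and> s + t = 0"
proof
  assume eq: "Poly_Mapping.single m s + Poly_Mapping.single m' t = 0"
  then have "Poly_Mapping.lookup (Poly_Mapping.single m s + Poly_Mapping.single m' t) m = 0" by simp
  then show "m = m' \<and> s + t = 0"
    using assms by (cases "m = m'") (auto simp: lookup_add lookup_single when_def)
qed (auto simp flip: single_add)

lemma prod_sign_of:
  assumes "ran \<sigma> \<subseteq> {1, -1}" "finite V"
  shows "(\<Prod>i\<in>V. sign_of \<sigma> i ^ e i) = (-1) ^ (\<Sum>i\<in>{i\<in>V. \<sigma> i = Some (-1)}. e i)"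
proof -
  have "(\<Prod>i\<in>V. sign_of \<sigma> i ^ e i) = (\<Prod>i\<in>V. (-1) ^ (if \<sigma> i = Some (-1) then e i else 0))"
  proof (rule prod.cong)
    fix i
    have "\<sigma> i = None \<or> \<sigma> i = Some 1 \<or> \<sigma> i = Some (-1)"
      using assms(1) by (cases "\<sigma> i") (auto simp: ran_def)
    then show "sign_of \<sigma> i ^ e i = (-1) ^ (if \<sigma> i = Some (-1) then e i else 0)"
      by (auto simp: sign_of_def)
  qed simp
  also have "\<dots> = (-1) ^ (\<Sum>i\<in>V. if \<sigma> i = Some (-1) then e i else 0)"
    by (simp add: power_sum)
  also have "(\<Sum>i\<in>V. if \<sigma> i = Some (-1) then e i else 0) = (\<Sum>i\<in>{i\<in>V. \<sigma> i = Some (-1)}. e i)"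
    using assms(2) by (simp add: sum.inter_filter)
  finally show ?thesis .
qed

text \<open>Two signed monomials cancel if and only if their exponents agree and their signs differ.
  The former says that no neighbour is unlabelled, the latter that the number of arrows to vertices
  labelled -1 is odd.\<close>

lemma specialise_exchange_poly_eq_0:
  assumes Q: "is_quiver n Q" and \<sigma>: "is_specialisation n \<sigma>" and "\<sigma> j = None"
  shows "specialise \<sigma> (exchange_poly {1..n} (quiver_matrix Q) j) = 0 \<longleftrightarrow> neighbourhood_is_polycule Q \<sigma> j"
proof -
  let ?V = "{1..n}" and ?S = "{i\<in>{1..n}. \<sigma> i = Some (-1)}"
  have ran: "ran \<sigma> \<subseteq> {1, -1}" using \<sigma> by (simp add: is_specialisation_def)
  have acyclic: "no_2_cycles Q" and supp: "Q i k \<noteq> 0 \<Longrightarrow> i \<in> ?V \<and> k \<in> ?V"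
    and loop: "Q i i = 0" for i k
    using Q by (auto simp: no_2_cycles_def is_quiver_def)
  let ?v = "\<lambda>e. vec ?V (\<lambda>i. if \<sigma> i = None then int (e i) else 0)"
  let ?s = "\<lambda>e. \<Prod>i\<in>?V. sign_of \<sigma> i ^ e i"
  have "specialise \<sigma> (exchange_poly ?V (quiver_matrix Q) j) =
      Poly_Mapping.single (?v (\<lambda>i. Q i j)) (?s (\<lambda>i. Q i j)) +
      Poly_Mapping.single (?v (\<lambda>i. Q j i)) (?s (\<lambda>i. Q j i))"
    unfolding exchange_poly_def max_quiver_matrix[OF acyclic]
    by (simp add: specialise_eq laurent_lift_add)
      (simp add: specialise_monomial_vec[OF ran] flip: specialise_eq)
  moreover have sign: "?s e = 1 \<or> ?s e = -1" for e
    unfolding prod_sign_of[OF ran finite_atLeastAtMost]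
    by (simp add: minus_one_power_iff)
  ultimately have "specialise \<sigma> (exchange_poly ?V (quiver_matrix Q) j) = 0 \<longleftrightarrow>
      ?v (\<lambda>i. Q i j) = ?v (\<lambda>i. Q j i) \<and> ?s (\<lambda>i. Q i j) + ?s (\<lambda>i. Q j i) = 0"
    by (simp add: single_add_single_eq_0)
  moreover have "?v (\<lambda>i. Q i j) = ?v (\<lambda>i. Q j i) \<longleftrightarrow> (\<forall>w\<in>neighbourhood Q j - {j}. \<sigma> w \<noteq> None)"
  proof -
    have "?v (\<lambda>i. Q i j) = ?v (\<lambda>i. Q j i) \<longleftrightarrow> (\<forall>i\<in>?V. \<sigma> i = None \<longrightarrow> Q i j = Q j i)"
      by (auto simp: poly_mapping_eq_iff fun_eq_iff lookup_vec)
    \<comment> \<open>Opposite arrows never coexist, so equal numbers in both directions are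
      zero.\<close>
    also have "\<dots> \<longleftrightarrow> (\<forall>i. \<sigma> i = None \<longrightarrow> Q i j = 0 \<and> Q j i = 0)"
      using acyclic supp unfolding no_2_cycles_def by metis
    also have "\<dots> \<longleftrightarrow> (\<forall>w\<in>neighbourhood Q j - {j}. \<sigma> w \<noteq> None)"
      using loop by (auto simp: neighbourhood_def)
    finally show ?thesis .
  qed
  moreover have "?s (\<lambda>i. Q i j) + ?s (\<lambda>i. Q j i) = 0 \<longleftrightarrow>
      odd (\<Sum>w\<in>{w\<in>neighbourhood Q j. \<sigma> w = Some (-1)}. Q j w + Q w j)"
  proof -
    have "?s (\<lambda>i. Q i j) + ?s (\<lambda>i. Q j i) = 0 \<longleftrightarrow> odd ((\<Sum>i\<in>?S. Q i j) + (\<Sum>i\<in>?S. Q j i))"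
      unfolding prod_sign_of[OF ran finite_atLeastAtMost] by (simp add: minus_one_power_iff)
    also have "(\<Sum>i\<in>?S. Q i j) + (\<Sum>i\<in>?S. Q j i) = (\<Sum>i\<in>?S. Q j i + Q i j)"
      by (simp add: sum.distrib)
    also have "\<dots> = (\<Sum>w\<in>{w\<in>neighbourhood Q j. \<sigma> w = Some (-1)}. Q j w + Q w j)"
      by (rule sum.mono_neutral_right)
        (use assms(3) supp in \<open>auto simp: neighbourhood_def\<close>)
    finally show ?thesis .
  qed
  ultimately show ?thesis using assms(3) by (simp add: neighbourhood_is_polycule_def)
qed

theorem theorem1:
  fixes n :: nat and Q :: quiver and \<sigma> :: "nat \<rightharpoonup> int" and j :: nat
  assumes "is_quiver n Q"
    and "is_specialisation n \<sigma>"
    and "j \<in> {1..n}"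
  shows "polyamorous n Q \<sigma> j \<longleftrightarrow> neighbourhood_is_polycule Q \<sigma> j"
proof (cases "\<sigma> j")
  case (Some a)
  then show ?thesis by (simp add: polyamorous_def neighbourhood_is_polycule_def)
next
  case None
  define P where "P = exchange_poly {1..n} (quiver_matrix Q) j"
  interpret laurent_substitution "specialise_power \<sigma>"
    using assms(2) by (intro laurent_substitution_specialise) (simp add: is_specialisation_def)
  have the_inv: "the_inv ratfun_of_laurent (laurent_eval X q) = q" for q
    using the_inv_f_f[OF laurent_eval_X_inj] by (simp add: ratfun_of_laurent_eq)
  have polynomial_in_eq: "polynomial_in j q \<longleftrightarrow> exponents_in j {0..} q" for q
    by (simp add: polynomial_in_def exponents_in_def)
  have "polyamorous n Q \<sigma> j \<longleftrightarrow> specialise \<sigma> P = 0"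
  proof
    assume "polyamorous n Q \<sigma> j"
    \<comment> \<open>The Laurent expansion of the variable created by the mutation at
      \<open>j\<close>.\<close>
    let ?q = "P * monomial (unit_vec j (-1))"
    have "no_2_cycles Q" using assms(1) by (simp add: no_2_cycles_def is_quiver_def)
    then have "mutate {1..n} j (quiver_matrix Q, X) =
        (quiver_matrix (fst (mutate_seed n j (Q, X))), snd (mutate_seed n j (Q, X)))"
      by (rule mutate_seed_eq) (rule X_nonzero)
    from arg_cong[OF this, of "\<lambda>s. snd s j"]
    have "snd (mutate_seed n j (initial_seed Q)) j = laurent_eval X P / X j"
      by (simp add: initial_seed_def mutate_def P_def)
    also have "\<dots> = laurent_eval X ?q"
      by (simp add: laurent_eval_mult X_nonzero power_int_minus divide_inverse)
    finally have "laurent_eval X ?q = snd (mutate_seed n j (initial_seed Q)) j" ..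
    moreover have "mutate_seed n j (initial_seed Q) \<in> seeds n Q"
      by (intro seeds.mutate seeds.initial assms(3))
    ultimately have "laurent_eval X ?q \<in> cluster_variables n Q"
      unfolding cluster_variables_def using assms(3) by blast
    then have "laurent_eval X ?q \<in> cluster_algebra n Q"
      unfolding cluster_algebra_def by (rule generated_subring.generator)
    then have "specialise \<sigma> ?q \<in> specialised_cluster_algebra n Q \<sigma>"
      unfolding specialised_cluster_algebra_def by (metis image_eqI the_inv)
    then have "exponents_in j {0..} (specialise \<sigma> ?q)"
      using \<open>polyamorous n Q \<sigma> j\<close> by (simp add: polyamorous_def polynomial_in_eq)
    \<comment> \<open>Every term has exponent -1 in \<open>x_j\<close>, also after specialisation
      because \<open>j\<close> is unlabelled; so being polynomial in \<open>x_j\<close> forces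
      zero.\<close>
    moreover have "exponents_in j {-1} ?q"
      unfolding P_def
      by (rule exponents_in_mult[OF exponents_in_exchange_poly[OF _ skew_on_quiver_matrix[OF assms(1)]]
            exponents_in_single[where A = "{-1}"]]) auto
    then have "exponents_in j {-1} (specialise \<sigma> ?q)"
      by (rule specialise_exponents[of \<sigma> j, OF None])
    ultimately have "specialise \<sigma> ?q = 0"
      by (force simp: exponents_in_def simp flip: keys_eq_empty)
    then have "specialise \<sigma> P * specialise \<sigma> (monomial (unit_vec j (-1))) = 0"
      by (simp add: specialise_eq lift_mult)
    moreover have "specialise \<sigma> (monomial (unit_vec j (-1))) = monomial (unit_vec j (-1))"
      using None by (simp add: specialise_eq laurent_lift_single specialise_power_def)
    ultimately show "specialise \<sigma> P = 0" by (auto dest: arg_cong[of _ _ Poly_Mapping.keys])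
  next
    assume P0: "specialise \<sigma> P = 0"
    have "polynomial_in j (specialise \<sigma> (the_inv ratfun_of_laurent f))" if f: "f \<in> cluster_algebra n Q" for f
    proof -
      obtain g u where u: "exponents_in j {0..} u" "f = laurent_eval X (P * g + u)"
        using cluster_algebra_expansion[OF assms(1,3) f] unfolding P_def by blast
      \<comment> \<open>The multiple of \<open>P\<close>, which may carry negative powers of
        \<open>x_j\<close>, is killed.\<close>
      have "specialise \<sigma> (P * g + u) = specialise \<sigma> u"
        using P0 by (simp add: specialise_eq laurent_lift_add lift_mult)
      then show ?thesis
        using specialise_exponents[of \<sigma> j, OF None u(1)] by (simp add: u(2) the_inv polynomial_in_eq)
    qed
    then show "polyamorous n Q \<sigma> j"
      using None by (auto simp: polyamorous_def specialised_cluster_algebra_def)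
  qed
  then show ?thesis
    using specialise_exchange_poly_eq_0[OF assms(1,2) None] by (simp add: P_def)
qed

end
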